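(* Let $f_1,\dots,f_m:[0,1]\to[0,1]$ and a probability vector $(p_1,\dots,p_m)$ with all $p_i>0$ satisfy: (A1) each $f_i$ is an increasing $C^2$ diffeomorphism of $[0,1]$; (A2) for every $x\in(0,1)$ there exist $i,j\in\{1,\dots,m\}$ with $f_i(x)<x<f_j(x)$; (A3) $\Lambda_0=\sum_{i=1}^m p_i\log f_i'(0)>0$ and $\Lambda_1=\sum_{i=1}^m p_i\log f_i'(1)>0$. Let $\mu_\ast$ be the unique stationary Borel probability measure with $\mu_\ast((0,1))=1$. Then there exist $q\in(0,1)$ and $C\ge1$ such that for all Lipschitz functions $\varphi,\psi:[0,1]\to\mathbb{R}$ and all $n\ge1$, $$\left|\int_0^1 U^n\varphi(x)\,\psi(x)\,d\mu_\ast(x)-\int_0^1\varphi\,d\mu_\ast\int_0^1\psi\,d\mu_\ast\right|\le C\,\|\varphi\|_{\mathrm{Lip}}\,\|\psi\|_{\mathrm{Lip}}\,q^n.$$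
   Context: For a bounded Borel function $\varphi:[0,1]\to\mathbb{R}$, $U\varphi(x)=\sum_{i=1}^m p_i\varphi(f_i(x))$. A Borel probability measure $\mu$ on $[0,1]$ is stationary if $P\mu=\mu$, where $P\mu(A)=\sum_{i=1}^m p_i\mu(f_i^{-1}(A))$ for Borel $A$. Under (A1)-(A3) it is known that there is exactly one stationary Borel probability measure $\mu_\ast$ on $[0,1]$ with $\mu_\ast((0,1))=1$. Lipschitz is understood with respect to the Euclidean metric $|x-y|$ on $[0,1]$, and $\|\varphi\|_{\mathrm{Lip}}=\|\varphi\|_\infty+\mathrm{Lip}(\varphi)$, where $\mathrm{Lip}(\varphi)$ is the optimal Lipschitz constant of $\varphi$. A $C^2$ diffeomorphism of $[0,1]$ is a $C^2$ bijection with $C^2$ inverse (one-sided derivatives at the endpoints). *)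

theory Defs
  imports "HOL-Probability.Probability"
begin

abbreviation I01 :: "real set"
  where "I01 \<equiv> {0..1}"

text \<open>Derivatives are taken within the unit interval, hence they are one-sided at the endpoints.
  The values of a function outside the unit interval are irrelevant throughout.\<close>

definition deriv01 :: "(real \<Rightarrow> real) \<Rightarrow> real \<Rightarrow> real"
  where "deriv01 f x = vector_derivative f (at x within I01)"

definition C2_01 :: "(real \<Rightarrow> real) \<Rightarrow> bool"
  where "C2_01 f \<longleftrightarrow>
    f differentiable_on I01 \<and> deriv01 f differentiable_on I01 \<and>
    continuous_on I01 (deriv01 (deriv01 f))"

definition C2_diffeo_01 :: "(real \<Rightarrow> real) \<Rightarrow> bool"
  where "C2_diffeo_01 f \<longleftrightarrow> bij_betw f I01 I01 \<and> C2_01 f \<and> C2_01 (inv_into I01 f)"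

definition markov_op ::
  "nat \<Rightarrow> (nat \<Rightarrow> real) \<Rightarrow> (nat \<Rightarrow> real \<Rightarrow> real) \<Rightarrow> (real \<Rightarrow> real) \<Rightarrow> real \<Rightarrow> real"
  where "markov_op m p f \<phi> x = (\<Sum>i=1..m. p i * \<phi> (f i x))"

definition transfer_op ::
  "nat \<Rightarrow> (nat \<Rightarrow> real) \<Rightarrow> (nat \<Rightarrow> real \<Rightarrow> real) \<Rightarrow> real measure \<Rightarrow> real set \<Rightarrow> real"
  where "transfer_op m p f \<mu> A = (\<Sum>i=1..m. p i * measure \<mu> (f i -` A \<inter> I01))"

definition borel_prob_01 :: "real measure \<Rightarrow> bool"
  where "borel_prob_01 \<mu> \<longleftrightarrow> prob_space \<mu> \<and> sets \<mu> = sets (restrict_space borel I01)"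

definition stationary ::
  "nat \<Rightarrow> (nat \<Rightarrow> real) \<Rightarrow> (nat \<Rightarrow> real \<Rightarrow> real) \<Rightarrow> real measure \<Rightarrow> bool"
  where "stationary m p f \<mu> \<longleftrightarrow> (\<forall>A\<in>sets \<mu>. transfer_op m p f \<mu> A = measure \<mu> A)"

definition lipschitz_01 :: "(real \<Rightarrow> real) \<Rightarrow> bool"
  where "lipschitz_01 \<phi> \<longleftrightarrow> (\<exists>L. L-lipschitz_on I01 \<phi>)"

definition sup_norm_01 :: "(real \<Rightarrow> real) \<Rightarrow> real"
  where "sup_norm_01 \<phi> = (SUP x\<in>I01. \<bar>\<phi> x\<bar>)"

definition Lip_const_01 :: "(real \<Rightarrow> real) \<Rightarrow> real"
  where "Lip_const_01 \<phi> = Inf {L. L-lipschitz_on I01 \<phi>}"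

definition Lip_norm_01 :: "(real \<Rightarrow> real) \<Rightarrow> real"
  where "Lip_norm_01 \<phi> = sup_norm_01 \<phi> + Lip_const_01 \<phi>"

end

theory Submission
  imports Defs
begin

text \<open>
  Since the maps are increasing, the oscillation of \<open>U\<^sup>n \<phi>\<close> between two points is at most the
  Lipschitz constant of \<open>\<phi>\<close> times that of \<open>U\<^sup>n id\<close>, so only iterates of the increasing function \<open>id\<close>
  have to be controlled. The positive exponents (A3) make \<open>V x = x powr (- a) + (1 - x) powr (- b)\<close>, for
  small \<open>a, b > 0\<close>, a Lyapunov function: \<open>U V \<le> \<kappa> V + K\<close> with \<open>\<kappa> < 1\<close>. By (A2) there is a time at which
  a whole sublevel interval of \<open>V\<close> is sent below 1/2 with positive probability, and above 1/2 with
  positive probability. For an increasing function the oscillations on the two sides of 1/2 do not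
  overlap, which gains a definite amount over the trivial estimate. As in Harris' theorem, drift and
  gain together show that a power of \<open>U\<close> contracts the oscillation of increasing functions relative to
  the weight \<open>2 + \<beta> V x + \<beta> V y\<close>. Finally \<open>V\<close> is integrable with respect to every stationary measure
  that does not charge the endpoints, so the pointwise estimate can be integrated.
\<close>

section \<open>Drift near a repelling endpoint\<close>

text \<open>As a function of \<open>\<alpha>\<close> the sum equals 1 at 0 and has derivative minus
  the exponent there, so it drops below 1 immediately to the right of 0.\<close>

lemma neg_moment_contraction:
  fixes p a :: "'i \<Rightarrow> real"
  assumes p_sum: "(\<Sum>i\<in>I. p i) = 1" and a_pos: "\<And>i. i \<in> I \<Longrightarrow> a i > 0"
    and exponent: "(\<Sum>i\<in>I. p i * ln (a i)) > 0"
  obtains \<alpha> where "\<alpha> > 0" and "(\<Sum>i\<in>I. p i * a i powr (-\<alpha>)) < 1"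
proof -
  define s where "s t = (\<Sum>i\<in>I. p i * exp (- (t * ln (a i))))" for t
  have "(s has_real_derivative (\<Sum>i\<in>I. p i * - ln (a i))) (at 0)"
    unfolding s_def by (auto intro!: derivative_eq_intros sum.cong)
  moreover have "(\<Sum>i\<in>I. p i * - ln (a i)) < 0"
    using exponent by (simp add: sum_negf)
  ultimately obtain d where d: "d > 0" "\<And>h. h > 0 \<Longrightarrow> h < d \<Longrightarrow> s (0 + h) < s 0"
    using DERIV_neg_dec_right by blast
  have "s (d/2) < 1"
    using d(2)[of "d/2"] d(1) p_sum by (simp add: s_def)
  moreover have "s (d/2) = (\<Sum>i\<in>I. p i * a i powr (-(d/2)))"
    unfolding s_def using a_pos by (intro sum.cong) (auto simp: powr_def dest: less_imp_neq[symmetric])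
  ultimately show ?thesis
    using that[of "d/2"] d(1) by simp
qed

text \<open>Close to 0 the ratio \<open>g i x / x\<close> is nearly \<open>a i\<close>, so averaging
  multiplies \<open>x powr (-\<alpha>)\<close> by a factor below 1. Away from 0, monotonicity bounds
  the sum by its value at a fixed point. The family \<open>g\<close> is abstract because the
  endpoint 1 is handled by the same lemma after reflection.\<close>

lemma powr_drift:
  fixes p a :: "'i \<Rightarrow> real" and g :: "'i \<Rightarrow> real \<Rightarrow> real"
  assumes p_pos: "\<And>i. i \<in> I \<Longrightarrow> p i > 0" and p_sum: "(\<Sum>i\<in>I. p i) = 1"
    and a_pos: "\<And>i. i \<in> I \<Longrightarrow> a i > 0"
    and exponent: "(\<Sum>i\<in>I. p i * ln (a i)) > 0"
    and slope: "\<And>i. i \<in> I \<Longrightarrow> ((\<lambda>x. g i x / x) \<longlongrightarrow> a i) (at_right 0)"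
    and g_pos: "\<And>i x. i \<in> I \<Longrightarrow> x \<in> {0<..<1} \<Longrightarrow> g i x > 0"
    and g_mono: "\<And>i. i \<in> I \<Longrightarrow> mono_on {0<..<1} (g i)"
  shows "\<exists>\<alpha> \<kappa> K. 0 < \<alpha> \<and> 0 < \<kappa> \<and> \<kappa> < 1 \<and> 0 \<le> K \<and>
    (\<forall>x\<in>{0<..<1}. (\<Sum>i\<in>I. p i * g i x powr (-\<alpha>)) \<le> \<kappa> * x powr (-\<alpha>) + K)"
proof -
  obtain \<alpha> where \<alpha>: "\<alpha> > 0" "(\<Sum>i\<in>I. p i * a i powr (-\<alpha>)) < 1"
    using neg_moment_contraction[OF p_sum a_pos exponent] by blast
  define s where "s = (\<Sum>i\<in>I. p i * a i powr (-\<alpha>))"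
  have "s \<ge> 0"
    unfolding s_def by (intro sum_nonneg mult_nonneg_nonneg) (auto simp: p_pos less_imp_le)
  \<comment> \<open>The midpoint of \<open>s\<close> and 1 leaves room for the error in the limit of
    the ratios.\<close>
  define \<kappa> where "\<kappa> = (1 + s) / 2"
  have \<kappa>: "0 < \<kappa>" "\<kappa> < 1" "s < \<kappa>"
    using \<alpha>(2) \<open>s \<ge> 0\<close> by (auto simp: \<kappa>_def s_def)
  have "((\<lambda>x. \<Sum>i\<in>I. p i * (g i x / x) powr (-\<alpha>)) \<longlongrightarrow> s) (at_right 0)"
    unfolding s_def by (intro tendsto_intros slope) (auto dest: a_pos)
  then have "\<forall>\<^sub>F x in at_right 0. (\<Sum>i\<in>I. p i * (g i x / x) powr (-\<alpha>)) < \<kappa>"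
    using \<kappa>(3) by (rule order_tendstoD)
  then obtain e where e: "e > 0"
    "\<And>x. 0 < x \<Longrightarrow> x < e \<Longrightarrow> (\<Sum>i\<in>I. p i * (g i x / x) powr (-\<alpha>)) < \<kappa>"
    unfolding eventually_at_right_field by auto
  \<comment> \<open>\<open>d\<close> lies below \<open>e\<close>, so it bounds from below every
    \<open>x\<close> outside the range of the limit estimate; the cap 1/2 keeps it in the unit
    interval when \<open>e\<close> is large.\<close>
  define d where "d = min (e/2) (1/2)"
  have d: "0 < d" "d < e" "d < 1"
    using e(1) by (auto simp: d_def)
  define K where "K = (\<Sum>i\<in>I. p i * g i d powr (-\<alpha>))"
  have K: "K \<ge> 0"
    unfolding K_def by (intro sum_nonneg mult_nonneg_nonneg) (auto simp: p_pos less_imp_le)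
  have "(\<Sum>i\<in>I. p i * g i x powr (-\<alpha>)) \<le> \<kappa> * x powr (-\<alpha>) + K" if x: "x \<in> {0<..<1}" for x
  proof (cases "x < e")
    case True
    have "(\<Sum>i\<in>I. p i * g i x powr (-\<alpha>)) = (\<Sum>i\<in>I. p i * (g i x / x) powr (-\<alpha>)) * x powr (-\<alpha>)"
      unfolding sum_distrib_right
    proof (rule sum.cong)
      fix i assume "i \<in> I"
      then show "p i * g i x powr - \<alpha> = p i * (g i x / x) powr - \<alpha> * x powr - \<alpha>"
        using x g_pos[of i x] by (simp flip: powr_mult)
    qed simp
    also have "\<dots> \<le> \<kappa> * x powr (-\<alpha>)"
      using e(2)[of x] x True by (intro mult_right_mono) auto
    finally show ?thesis using K by simp
  next
    case False
    have "(\<Sum>i\<in>I. p i * g i x powr (-\<alpha>)) \<le> K"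
      unfolding K_def
    proof (intro sum_mono mult_left_mono)
      fix i assume i: "i \<in> I"
      have "g i d \<le> g i x"
        using x d False by (intro mono_onD[OF g_mono[OF i]]) auto
      then show "g i x powr - \<alpha> \<le> g i d powr - \<alpha>"
        using g_pos[OF i, of d] d \<alpha>(1) by (intro powr_mono2') auto
    qed (auto dest: p_pos)
    then show ?thesis
      using \<kappa>(1) by (smt (verit) mult_nonneg_nonneg powr_ge_zero)
  qed
  then show ?thesis
    using \<alpha>(1) \<kappa> K by blast
qed

lemma powr_neg_le_imp_ge:
  fixes x R \<alpha> :: real
  assumes "0 < \<alpha>" "0 < x" "0 < R" "x powr (-\<alpha>) \<le> R"
  shows "R powr (-1/\<alpha>) \<le> x"
proof -
  have "R powr (-1/\<alpha>) \<le> (x powr (-\<alpha>)) powr (-1/\<alpha>)"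
    using assms by (intro powr_mono2') auto
  also have "\<dots> = x"
    using assms by (simp add: powr_powr)
  finally show ?thesis .
qed

section \<open>Contraction of weighted oscillations\<close>

locale increasing_ifs =
  fixes m :: nat and p :: "nat \<Rightarrow> real" and f :: "nat \<Rightarrow> real \<Rightarrow> real"
  assumes p_pos: "\<And>i. i \<in> {1..m} \<Longrightarrow> p i > 0"
    and p_sum: "(\<Sum>i=1..m. p i) = 1"
    and f_strict_mono: "\<And>i. i \<in> {1..m} \<Longrightarrow> strict_mono_on I01 (f i)"
    and f_cont: "\<And>i. i \<in> {1..m} \<Longrightarrow> continuous_on I01 (f i)"
    and f_0: "\<And>i. i \<in> {1..m} \<Longrightarrow> f i 0 = 0"
    and f_1: "\<And>i. i \<in> {1..m} \<Longrightarrow> f i 1 = 1"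
begin

section \<open>The averaging operator and the two-point motion\<close>

abbreviation U :: "(real \<Rightarrow> real) \<Rightarrow> real \<Rightarrow> real"
  where "U \<equiv> markov_op m p f"

text \<open>The Markov operator of the synchronous coupling: both points are moved by the same
  randomly chosen map.\<close>

definition pair_op :: "(real \<Rightarrow> real \<Rightarrow> real) \<Rightarrow> real \<Rightarrow> real \<Rightarrow> real"
  where "pair_op G x y = (\<Sum>i=1..m. p i * G (f i x) (f i y))"

lemma f_mono: "i \<in> {1..m} \<Longrightarrow> 0 \<le> x \<Longrightarrow> x \<le> y \<Longrightarrow> y \<le> 1 \<Longrightarrow> f i x \<le> f i y"
  using strict_mono_on_leD[OF f_strict_mono, of i x y] by auto

lemma f_less: "i \<in> {1..m} \<Longrightarrow> 0 \<le> x \<Longrightarrow> x < y \<Longrightarrow> y \<le> 1 \<Longrightarrow> f i x < f i y"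
  using strict_mono_onD[OF f_strict_mono, of i x y] by auto

lemma f_closed: "i \<in> {1..m} \<Longrightarrow> x \<in> I01 \<Longrightarrow> f i x \<in> I01"
  using f_mono[of i 0 x] f_mono[of i x 1] by (auto simp: f_0 f_1)

lemma f_open: "i \<in> {1..m} \<Longrightarrow> x \<in> {0<..<1} \<Longrightarrow> f i x \<in> {0<..<1}"
  using f_less[of i 0 x] f_less[of i x 1] by (auto simp: f_0 f_1)

lemma U_le:
  assumes "x \<in> {0<..<1}" and "\<And>z. z \<in> {0<..<1} \<Longrightarrow> \<phi> z \<le> \<psi> z"
  shows "U \<phi> x \<le> U \<psi> x"
  unfolding markov_op_def using assms p_pos
  by (intro sum_mono mult_left_mono) (auto simp: f_open less_imp_le simp del: greaterThanLessThan_iff)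

lemma U_const: "U (\<lambda>_. c) x = c"
  using p_sum by (simp add: markov_op_def flip: sum_distrib_right)

lemma U_lin: "U (\<lambda>x. a * \<phi> x + b * \<psi> x) x = a * U \<phi> x + b * U \<psi> x"
  unfolding markov_op_def by (simp add: algebra_simps sum.distrib sum_distrib_left)

lemma U_pow_lin:
  "(U ^^ n) (\<lambda>x. a * \<phi> x + b * \<psi> x) x = a * (U ^^ n) \<phi> x + b * (U ^^ n) \<psi> x"
proof (induction n arbitrary: x)
  case (Suc n)
  then have "(U ^^ n) (\<lambda>x. a * \<phi> x + b * \<psi> x) = (\<lambda>x. a * (U ^^ n) \<phi> x + b * (U ^^ n) \<psi> x)"
    by blast
  then show ?case by (simp add: U_lin)
qed simp

text \<open>Each coordinate of the coupled motion is itself a copy of the one-point motion, and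
  constants survive because the weights sum to 1.\<close>

lemma pair_op_pow_separate:
  "(pair_op ^^ n) (\<lambda>x y. c + \<phi> x + \<psi> y) x y = c + (U ^^ n) \<phi> x + (U ^^ n) \<psi> y"
proof (induction n arbitrary: x y)
  case (Suc n)
  have "(pair_op ^^ n) (\<lambda>x y. c + \<phi> x + \<psi> y) = (\<lambda>x y. c + (U ^^ n) \<phi> x + (U ^^ n) \<psi> y)"
    by (intro ext Suc.IH)
  then have "(pair_op ^^ Suc n) (\<lambda>x y. c + \<phi> x + \<psi> y) x y
    = pair_op (\<lambda>x y. c + (U ^^ n) \<phi> x + (U ^^ n) \<psi> y) x y"
    by simp
  also have "\<dots> = c * (\<Sum>i=1..m. p i) + (U ^^ Suc n) \<phi> x + (U ^^ Suc n) \<psi> y"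
    unfolding pair_op_def funpow.simps comp_def markov_op_def
    by (simp only: ring_distribs sum.distrib sum_distrib_left mult.commute)
  finally show ?case by (simp only: p_sum mult_1_right)
qed simp

text \<open>Increasing maps preserve the order of the two points, so the ordered region is invariant
  under the coupled motion and a sign condition on it is enough.\<close>

lemma pair_op_pow_nonneg:
  assumes "\<And>x y. 0 < x \<Longrightarrow> x \<le> y \<Longrightarrow> y < 1 \<Longrightarrow> E x y \<ge> 0"
    and "0 < x" "x \<le> y" "y < 1"
  shows "(pair_op ^^ n) E x y \<ge> 0"
  using assms(2-)
proof (induction n arbitrary: x y)
  case (Suc n)
  show ?case
    unfolding funpow.simps comp_def pair_op_def[of "(pair_op ^^ n) E"]
  proof (intro sum_nonneg mult_nonneg_nonneg Suc.IH)
    fix i assume i: "i \<in> {1..m}"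
    show "p i \<ge> 0" using p_pos[OF i] by simp
    show "0 < f i x" "f i x \<le> f i y" "f i y < 1"
      using f_open[OF i, of x] f_open[OF i, of y] f_mono[OF i, of x y] Suc.prems by auto
  qed
qed (use assms in auto)

lemma pair_op_ge_term:
  assumes "\<And>x y. 0 < x \<Longrightarrow> x \<le> y \<Longrightarrow> y < 1 \<Longrightarrow> E x y \<ge> 0"
    and "0 < x" "x \<le> y" "y < 1" and i: "i \<in> {1..m}"
  shows "p i * E (f i x) (f i y) \<le> pair_op E x y"
  unfolding pair_op_def
proof (rule member_le_sum[OF i])
  fix j assume "j \<in> {1..m} - {i}"
  then have j: "j \<in> {1..m}" by auto
  show "0 \<le> p j * E (f j x) (f j y)"
    using f_open[OF j, of x] f_open[OF j, of y] f_mono[OF j, of x y] assms p_pos[OF j]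
    by (intro mult_nonneg_nonneg) auto
qed simp

section \<open>Paths along the extremal maps\<close>

definition down :: "real \<Rightarrow> real" where "down x = Min ((\<lambda>i. f i x) ` {1..m})"
definition up :: "real \<Rightarrow> real" where "up x = Max ((\<lambda>i. f i x) ` {1..m})"
text \<open>Every prescribed word of \<open>n\<close> maps is drawn with probability at least
  \<open>p_min ^ n\<close>, whichever maps occur in it.\<close>

definition p_min :: real where "p_min = Min (p ` {1..m})"

lemma maps_nonempty: "{1..m} \<noteq> {}"
  using p_sum by (cases "m = 0") auto

lemma p_min: "0 < p_min" "i \<in> {1..m} \<Longrightarrow> p_min \<le> p i"
  using maps_nonempty p_pos unfolding p_min_def by (subst Min_gr_iff) auto

lemma down_attained: obtains i where "i \<in> {1..m}" "f i x = down x"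
proof -
  have "down x \<in> (\<lambda>i. f i x) ` {1..m}"
    unfolding down_def using maps_nonempty by (intro Min_in) auto
  then show ?thesis using that by auto
qed

lemma up_attained: obtains i where "i \<in> {1..m}" "f i x = up x"
proof -
  have "up x \<in> (\<lambda>i. f i x) ` {1..m}"
    unfolding up_def using maps_nonempty by (intro Max_in) auto
  then show ?thesis using that by auto
qed

text \<open>Both points follow the map that is lowest at the upper point (below: highest at the lower point), so
  the path of one of the two points is explicit.\<close>

lemma pair_op_pow_down:
  assumes E: "\<And>x y. 0 < x \<Longrightarrow> x \<le> y \<Longrightarrow> y < 1 \<Longrightarrow> E x y \<ge> 0"
    and "0 < x" "x \<le> y" "y < 1"
  shows "\<exists>x'. 0 < x' \<and> x' \<le> (down ^^ n) y \<and> (down ^^ n) y < 1 \<and>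
    p_min ^ n * E x' ((down ^^ n) y) \<le> (pair_op ^^ n) E x y"
  using assms(2-)
proof (induction n arbitrary: x y)
  case 0
  then show ?case by auto
next
  case (Suc n)
  obtain i where i: "i \<in> {1..m}" "f i y = down y"
    by (rule down_attained)
  have xy: "0 < f i x" "f i x \<le> down y" "down y < 1"
    using f_open[OF i(1), of x] f_open[OF i(1), of y] f_mono[OF i(1), of x y] Suc.prems i by auto
  obtain x' where x': "0 < x'" "x' \<le> (down ^^ n) (down y)" "(down ^^ n) (down y) < 1"
    "p_min ^ n * E x' ((down ^^ n) (down y)) \<le> (pair_op ^^ n) E (f i x) (down y)"
    using Suc.IH[OF xy] by blast
  have "p_min ^ Suc n * E x' ((down ^^ n) (down y)) \<le> p_min * (pair_op ^^ n) E (f i x) (down y)"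
    using x'(4) p_min(1) by (simp add: mult.assoc)
  also have "\<dots> \<le> p i * (pair_op ^^ n) E (f i x) (down y)"
    using p_min(2)[OF i(1)] pair_op_pow_nonneg[OF E xy] by (intro mult_right_mono) auto
  also have "\<dots> \<le> (pair_op ^^ Suc n) E x y"
    using pair_op_ge_term[where E = "(pair_op ^^ n) E", OF pair_op_pow_nonneg[OF E] Suc.prems i(1)] i(2) by simp
  finally show ?case
    using x' by (auto simp: funpow_swap1 intro!: exI[of _ x'])
qed

lemma pair_op_pow_up:
  assumes E: "\<And>x y. 0 < x \<Longrightarrow> x \<le> y \<Longrightarrow> y < 1 \<Longrightarrow> E x y \<ge> 0"
    and "0 < x" "x \<le> y" "y < 1"
  shows "\<exists>y'. 0 < (up ^^ n) x \<and> (up ^^ n) x \<le> y' \<and> y' < 1 \<and>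
    p_min ^ n * E ((up ^^ n) x) y' \<le> (pair_op ^^ n) E x y"
  using assms(2-)
proof (induction n arbitrary: x y)
  case 0
  then show ?case by auto
next
  case (Suc n)
  obtain i where i: "i \<in> {1..m}" "f i x = up x"
    by (rule up_attained)
  have xy: "0 < up x" "up x \<le> f i y" "f i y < 1"
    using f_open[OF i(1), of x] f_open[OF i(1), of y] f_mono[OF i(1), of x y] Suc.prems i by auto
  obtain y' where y': "0 < (up ^^ n) (up x)" "(up ^^ n) (up x) \<le> y'" "y' < 1"
    "p_min ^ n * E ((up ^^ n) (up x)) y' \<le> (pair_op ^^ n) E (up x) (f i y)"
    using Suc.IH[OF xy] by blast
  have "p_min ^ Suc n * E ((up ^^ n) (up x)) y' \<le> p_min * (pair_op ^^ n) E (up x) (f i y)"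
    using y'(4) p_min(1) by (simp add: mult.assoc)
  also have "\<dots> \<le> p i * (pair_op ^^ n) E (up x) (f i y)"
    using p_min(2)[OF i(1)] pair_op_pow_nonneg[OF E xy] by (intro mult_right_mono) auto
  also have "\<dots> \<le> (pair_op ^^ Suc n) E x y"
    using pair_op_ge_term[where E = "(pair_op ^^ n) E", OF pair_op_pow_nonneg[OF E] Suc.prems i(1)] i(2) by simp
  finally show ?case
    using y' by (auto simp: funpow_swap1 intro!: exI[of _ y'])
qed


lemma down_bounds: "x \<in> {0<..<1} \<Longrightarrow> down x \<in> {0<..<1}"
  using f_open down_attained[of x] by metis

lemma up_bounds: "x \<in> {0<..<1} \<Longrightarrow> up x \<in> {0<..<1}"
  using f_open up_attained[of x] by metis

lemma down_le: "i \<in> {1..m} \<Longrightarrow> down x \<le> f i x"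
  unfolding down_def by (intro Min_le) auto

lemma le_up: "i \<in> {1..m} \<Longrightarrow> f i x \<le> up x"
  unfolding up_def by (intro Max_ge) auto

text \<open>The iterates decrease because some map lies below the identity at each point. If the
  limit \<open>L\<close> were positive, a map with \<open>f i L < L\<close> would, by its
  continuity, send a late iterate below \<open>L\<close>, and the next iterate would be lower still.
  Only continuity of the single map is used, not of the envelope \<open>down\<close>.\<close>

lemma down_pow_tendsto_0:
  assumes A2: "\<And>x. x \<in> {0<..<1} \<Longrightarrow> \<exists>i\<in>{1..m}. f i x < x" and b: "b \<in> {0<..<1}"
  shows "(\<lambda>n. (down ^^ n) b) \<longlonglongrightarrow> 0"
proof -
  define s where "s n = (down ^^ n) b" for n
  have s01: "s n \<in> {0<..<1}" for n
    unfolding s_def by (induction n) (use b down_bounds in auto)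
  have s_closed: "s n \<in> I01" for n
    using s01[of n] by auto
  have "decseq s"
  proof (rule decseq_SucI)
    fix n
    obtain i where "i \<in> {1..m}" "f i (s n) < s n" using A2[OF s01] by blast
    then show "s (Suc n) \<le> s n"
      using down_le[of i "s n"] by (simp add: s_def)
  qed
  moreover have "0 \<le> s n" for n
    using s_closed[of n] by simp
  ultimately obtain L where L: "s \<longlonglongrightarrow> L" "\<And>n. L \<le> s n"
    using decseq_convergent[of s 0] by blast
  have "L \<ge> 0"
    using s_closed by (intro LIMSEQ_le_const[OF L(1)]) auto
  have "L = 0"
  proof (rule ccontr)
    assume "L \<noteq> 0"
    then have L01: "L \<in> {0<..<1}"
      using \<open>L \<ge> 0\<close> L(2)[of 0] s01[of 0] by auto
    then obtain i where i: "i \<in> {1..m}" "f i L < L" using A2 by blast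
    have "(\<lambda>n. f i (s n)) \<longlonglongrightarrow> f i L"
      using s_closed L01 by (intro continuous_on_tendsto_compose[OF f_cont[OF i(1)] L(1)]) auto
    then have "\<forall>\<^sub>F n in sequentially. f i (s n) < L"
      using i(2) by (rule order_tendstoD)
    then obtain n where "f i (s n) < L"
      by (auto simp: eventually_sequentially)
    then show False
      using L(2)[of "Suc n"] down_le[OF i(1), of "s n"] by (simp add: s_def)
  qed
  then show ?thesis
    using L(1) by (simp add: s_def[abs_def])
qed

lemma up_pow_tendsto_1:
  assumes A2: "\<And>x. x \<in> {0<..<1} \<Longrightarrow> \<exists>i\<in>{1..m}. x < f i x" and a: "a \<in> {0<..<1}"
  shows "(\<lambda>n. (up ^^ n) a) \<longlonglongrightarrow> 1"
proof -
  define s where "s n = (up ^^ n) a" for n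
  have s01: "s n \<in> {0<..<1}" for n
    unfolding s_def by (induction n) (use a up_bounds in auto)
  have s_closed: "s n \<in> I01" for n
    using s01[of n] by auto
  have "incseq s"
  proof (rule incseq_SucI)
    fix n
    obtain i where "i \<in> {1..m}" "s n < f i (s n)" using A2[OF s01] by blast
    then show "s n \<le> s (Suc n)"
      using le_up[of i "s n"] by (simp add: s_def)
  qed
  moreover have "s n \<le> 1" for n
    using s_closed[of n] by simp
  ultimately obtain L where L: "s \<longlonglongrightarrow> L" "\<And>n. s n \<le> L"
    using incseq_convergent[of s 1] by blast
  have "L \<le> 1"
    using s_closed by (intro LIMSEQ_le_const2[OF L(1)]) auto
  have "L = 1"
  proof (rule ccontr)
    assume "L \<noteq> 1"
    then have L01: "L \<in> {0<..<1}"
      using \<open>L \<le> 1\<close> L(2)[of 0] s01[of 0] by auto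
    then obtain i where i: "i \<in> {1..m}" "L < f i L" using A2 by blast
    have "(\<lambda>n. f i (s n)) \<longlonglongrightarrow> f i L"
      using s_closed L01 by (intro continuous_on_tendsto_compose[OF f_cont[OF i(1)] L(1)]) auto
    then have "\<forall>\<^sub>F n in sequentially. L < f i (s n)"
      using i(2) by (rule order_tendstoD)
    then obtain n where "L < f i (s n)"
      by (auto simp: eventually_sequentially)
    then show False
      using L(2)[of "Suc n"] le_up[OF i(1), of "s n"] by (simp add: s_def)
  qed
  then show ?thesis
    using L(1) by (simp add: s_def[abs_def])
qed

text \<open>The map attaining the minimum at the upper point sends the lower point no higher, so the
  lower envelope inherits monotonicity.\<close>

lemma down_pow_mono:
  assumes "0 < x" "x \<le> y" "y < 1"
  shows "(down ^^ n) x \<le> (down ^^ n) y"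
proof (induction n)
  case (Suc n)
  have in01: "(down ^^ k) z \<in> {0<..<1}" if "z \<in> {0<..<1}" for k z
    by (induction k) (use that down_bounds in auto)
  obtain i where i: "i \<in> {1..m}" "f i ((down ^^ n) y) = down ((down ^^ n) y)"
    by (rule down_attained)
  then show ?case
    using down_le[OF i(1), of "(down ^^ n) x"] f_mono[OF i(1) _ Suc] in01[of x n] in01[of y n] assms
    by auto
qed (use assms in auto)

lemma up_pow_mono:
  assumes "0 < x" "x \<le> y" "y < 1"
  shows "(up ^^ n) x \<le> (up ^^ n) y"
proof (induction n)
  case (Suc n)
  have in01: "(up ^^ k) z \<in> {0<..<1}" if "z \<in> {0<..<1}" for k z
    by (induction k) (use that up_bounds in auto)
  obtain i where i: "i \<in> {1..m}" "f i ((up ^^ n) x) = up ((up ^^ n) x)"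
    by (rule up_attained)
  then show ?case
    using le_up[OF i(1), of "(up ^^ n) y"] f_mono[OF i(1) _ Suc] in01[of x n] in01[of y n] assms
    by auto
qed (use assms in auto)

text \<open>Both limits give inequalities valid at all late times, hence at a common one;
  monotonicity in the starting point extends them from \<open>b\<close> and \<open>a\<close> to all
  points on the relevant side. This yields one block length serving a whole sublevel interval of the
  Lyapunov function.\<close>

lemma common_crossing_time:
  assumes A2: "\<And>x. x \<in> {0<..<1} \<Longrightarrow> \<exists>i\<in>{1..m}. \<exists>j\<in>{1..m}. f i x < x \<and> x < f j x"
    and ab: "a \<in> {0<..<1}" "b \<in> {0<..<1}"
  obtains N where "N \<ge> 1" "\<And>y. 0 < y \<Longrightarrow> y \<le> b \<Longrightarrow> (down ^^ N) y \<le> 1/2"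
    "\<And>x. a \<le> x \<Longrightarrow> x < 1 \<Longrightarrow> 1/2 \<le> (up ^^ N) x"
proof -
  have d: "\<exists>i\<in>{1..m}. f i x < x" and u: "\<exists>i\<in>{1..m}. x < f i x" if "x \<in> {0<..<1}" for x
    using A2[OF that] by blast+
  have "\<forall>\<^sub>F n in sequentially. (down ^^ n) b < 1/2 \<and> (up ^^ n) a > 1/2 \<and> n \<ge> 1"
    using order_tendstoD(2)[OF down_pow_tendsto_0[OF d ab(2)], of "1/2"]
      order_tendstoD(1)[OF up_pow_tendsto_1[OF u ab(1)], of "1/2"] eventually_ge_at_top[of 1]
    by (intro eventually_conj) auto
  then obtain N where N: "(down ^^ N) b < 1/2" "(up ^^ N) a > 1/2" "N \<ge> 1"
    by (auto simp: eventually_sequentially)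
  show ?thesis
  proof (rule that[of N])
    fix y :: real assume "0 < y" "y \<le> b"
    then show "(down ^^ N) y \<le> 1/2"
      using down_pow_mono[of y b N] N ab by auto
  next
    fix x assume "a \<le> x" "x < 1"
    then show "1/2 \<le> (up ^^ N) x"
      using up_pow_mono[of a x N] N ab by auto
  qed fact
qed

lemma U_pow_drift:
  assumes \<kappa>: "0 \<le> \<kappa>" "\<kappa> < 1"
    and drift: "\<And>x. x \<in> {0<..<1} \<Longrightarrow> U V x \<le> \<kappa> * V x + K * (1 - \<kappa>)"
    and "K \<ge> 0" and x: "x \<in> {0<..<1}"
  shows "(U ^^ n) V x \<le> \<kappa> ^ n * V x + K"
proof -
  \<comment> \<open>Writing the additive constant of the drift as \<open>K * (1 - \<kappa>)\<close>
    makes the geometric sum telescope to \<open>K * (1 - \<kappa> ^ n)\<close>, which never exceeds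
    \<open>K\<close>.\<close>
  have "(U ^^ n) V x \<le> \<kappa> ^ n * V x + K * (1 - \<kappa> ^ n)"
    using x
  proof (induction n arbitrary: x)
    case (Suc n)
    have "(U ^^ Suc n) V x \<le> U (\<lambda>x. \<kappa> ^ n * V x + (K * (1 - \<kappa> ^ n)) * 1) x"
      unfolding funpow.simps comp_def using Suc by (intro U_le) auto
    also have "\<dots> = \<kappa> ^ n * U V x + K * (1 - \<kappa> ^ n)"
      by (simp only: U_lin U_const mult_1_right)
    also have "\<dots> \<le> \<kappa> ^ n * (\<kappa> * V x + K * (1 - \<kappa>)) + K * (1 - \<kappa> ^ n)"
      using drift[OF Suc.prems] \<kappa> by (intro add_right_mono mult_left_mono) auto
    also have "\<dots> = \<kappa> ^ Suc n * V x + K * (1 - \<kappa> ^ Suc n)"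
      by (simp add: algebra_simps)
    finally show ?case .
  qed simp
  moreover have "K * (1 - \<kappa> ^ n) \<le> K"
    using assms by (simp add: mult_left_le)
  ultimately show ?thesis by linarith
qed

text \<open>The second claim keeps only two branches of the expanded nonnegative excess \<open>E\<close> below. The branches may
  coincide, which is harmless since the total dominates each of them, hence their average.\<close>

lemma splitting_estimate:
  assumes A: "A \<ge> 0" and \<beta>: "\<beta> \<ge> 0"
    and V: "\<And>x. x \<in> {0<..<1} \<Longrightarrow> V x \<ge> 0"
    and osc: "\<And>x y. 0 < x \<Longrightarrow> x \<le> y \<Longrightarrow> y < 1 \<Longrightarrow> h y - h x \<le> A * (2 + \<beta> * V x + \<beta> * V y)"
    and h_mono: "mono_on {0<..<1} h"
    and xy: "0 < x" "x \<le> y" "y < 1"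
  shows "(U ^^ n) h y - (U ^^ n) h x \<le> A * (2 + \<beta> * (U ^^ n) V x + \<beta> * (U ^^ n) V y)"
    and "(down ^^ n) y \<le> 1/2 \<Longrightarrow> 1/2 \<le> (up ^^ n) x \<Longrightarrow>
      (U ^^ n) h y - (U ^^ n) h x \<le>
        A * (2 - p_min ^ n + \<beta> * (U ^^ n) V x + \<beta> * (U ^^ n) V y)"
proof -
  \<comment> \<open>The excess of the assumed bound over the actual oscillation, split into a
    constant, a function of \<open>x\<close> and a function of \<open>y\<close>. The coefficients
    \<open>1\<close> and \<open>-1\<close> are explicit so that \<open>U_pow_lin\<close> rewrites
    it.\<close>
  define E where "E x y = 2 * A + (A * \<beta> * V x + 1 * h x) + (A * \<beta> * V y + (-1) * h y)" for x y
  have E: "E x y \<ge> 0" if "0 < x" "x \<le> y" "y < 1" for x y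
    using osc[OF that] by (simp add: E_def algebra_simps)
  have TE: "(pair_op ^^ n) E x y = A * (2 + \<beta> * (U ^^ n) V x + \<beta> * (U ^^ n) V y)
    - ((U ^^ n) h y - (U ^^ n) h x)"
    unfolding E_def pair_op_pow_separate U_pow_lin by (simp add: algebra_simps)
  show "(U ^^ n) h y - (U ^^ n) h x \<le> A * (2 + \<beta> * (U ^^ n) V x + \<beta> * (U ^^ n) V y)"
    using pair_op_pow_nonneg[of E x y n, OF E xy] TE by simp
  assume c: "(down ^^ n) y \<le> 1/2" "1/2 \<le> (up ^^ n) x"
  obtain x1 where x1: "0 < x1" "x1 \<le> (down ^^ n) y" "(down ^^ n) y < 1"
    "p_min ^ n * E x1 ((down ^^ n) y) \<le> (pair_op ^^ n) E x y"
    using pair_op_pow_down[of E x y n, OF E xy] by blast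
  obtain y2 where y2: "0 < (up ^^ n) x" "(up ^^ n) x \<le> y2" "y2 < 1"
    "p_min ^ n * E ((up ^^ n) x) y2 \<le> (pair_op ^^ n) E x y"
    using pair_op_pow_up[of E x y n, OF E xy] by blast
  have h: "h ((down ^^ n) y) \<le> h ((up ^^ n) x)"
    using x1 y2 c by (intro mono_onD[OF h_mono]) auto
  have V2: "A * \<beta> * V ((down ^^ n) y) \<ge> 0" "A * \<beta> * V ((up ^^ n) x) \<ge> 0"
    using x1 y2 A \<beta> by (auto intro!: mult_nonneg_nonneg V)
  \<comment> \<open>The four points are ordered as \<open>x1\<close>, \<open>(down ^^ n) y\<close>,
    \<open>(up ^^ n) x\<close>, \<open>y2\<close>, so the oscillations of \<open>h\<close> on the
    two outer pairs together are at most \<open>h y2 - h x1\<close>. This is paid for by one bound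
    with constant \<open>2 * A\<close>, while two such constants are available; the spare one is the
    gain.\<close>
  have "2 * A \<le> E x1 ((down ^^ n) y) + E ((up ^^ n) x) y2"
    using osc[of x1 y2] x1 y2 c h V2 by (simp add: E_def algebra_simps)
  then have "p_min ^ n * (2 * A) \<le> p_min ^ n * (E x1 ((down ^^ n) y) + E ((up ^^ n) x) y2)"
    using p_min(1) by (intro mult_left_mono) auto
  also have "\<dots> \<le> 2 * (pair_op ^^ n) E x y"
    using x1(4) y2(4) by (simp add: algebra_simps)
  finally show "(U ^^ n) h y - (U ^^ n) h x \<le>
        A * (2 - p_min ^ n + \<beta> * (U ^^ n) V x + \<beta> * (U ^^ n) V y)"
    unfolding TE by (simp add: algebra_simps)
qed

text \<open>Two regimes, according to the size of \<open>V x + V y\<close>. When it is large, the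
  drift shrinks the weight. When it is small, both points lie in a sublevel interval and the
  splitting gain lowers the constant 2. A small \<open>\<beta>\<close> keeps the additive constant
  of the drift below that gain.\<close>

lemma weighted_oscillation_contraction:
  assumes A2: "\<And>x. x \<in> {0<..<1} \<Longrightarrow> \<exists>i\<in>{1..m}. \<exists>j\<in>{1..m}. f i x < x \<and> x < f j x"
    and \<kappa>: "0 < \<kappa>" "\<kappa> < 1" and K: "K \<ge> 0"
    and V: "\<And>x. x \<in> {0<..<1} \<Longrightarrow> V x \<ge> 0"
    and drift: "\<And>x. x \<in> {0<..<1} \<Longrightarrow> U V x \<le> \<kappa> * V x + K * (1 - \<kappa>)"
    and sublevel: "\<And>R. R > 0 \<Longrightarrow> \<exists>a\<in>{0<..<1}. \<exists>b\<in>{0<..<1}. \<forall>x\<in>{0<..<1}. V x \<le> R \<longrightarrow> a \<le> x \<and> x \<le> b"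
  shows "\<exists>N \<beta> \<theta>. N \<ge> 1 \<and> \<beta> > 0 \<and> 0 < \<theta> \<and> \<theta> < 1 \<and>
    (\<forall>h A. A \<ge> 0 \<longrightarrow> mono_on {0<..<1} h \<longrightarrow>
      (\<forall>x y. 0 < x \<longrightarrow> x \<le> y \<longrightarrow> y < 1 \<longrightarrow> h y - h x \<le> A * (2 + \<beta> * V x + \<beta> * V y)) \<longrightarrow>
      (\<forall>x y. 0 < x \<longrightarrow> x \<le> y \<longrightarrow> y < 1 \<longrightarrow>
        (U ^^ N) h y - (U ^^ N) h x \<le> \<theta> * A * (2 + \<beta> * V x + \<beta> * V y)))"
proof -
  \<comment> \<open>Above this level the additive \<open>2 * K\<close> is absorbed by half of the
    gap \<open>1 - \<kappa>\<close>, which leaves the rate \<open>\<kappa>'\<close> defined below.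
    The summand 1 keeps \<open>R\<close> positive when \<open>K = 0\<close>.\<close>
  define R where "R = 4 * K / (1 - \<kappa>) + 1"
  have R: "R > 0" "2 * K \<le> (1 - \<kappa>) / 2 * R"
  proof -
    show "R > 0" using \<kappa> K by (auto simp: R_def intro!: add_nonneg_pos)
    have "(1 - \<kappa>) * R = 4 * K + (1 - \<kappa>)"
      using \<kappa> by (simp add: R_def distrib_left)
    then show "2 * K \<le> (1 - \<kappa>) / 2 * R" using \<kappa> by simp
  qed
  obtain a b where ab: "a \<in> {0<..<1}" "b \<in> {0<..<1}"
    "\<And>x. x \<in> {0<..<1} \<Longrightarrow> V x \<le> R \<Longrightarrow> a \<le> x \<and> x \<le> b"
    using sublevel[OF R(1)] by metis
  obtain N where N: "N \<ge> 1" "\<And>y. 0 < y \<Longrightarrow> y \<le> b \<Longrightarrow> (down ^^ N) y \<le> 1/2"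
    "\<And>x. a \<le> x \<Longrightarrow> x < 1 \<Longrightarrow> 1/2 \<le> (up ^^ N) x"
    using common_crossing_time[OF A2 ab(1,2)] by metis
  define \<delta> where "\<delta> = p_min ^ N"
  have "\<delta> > 0" using p_min(1) by (simp add: \<delta>_def)
  have "\<delta> \<le> 1"
  proof -
    obtain i where i: "i \<in> {1..m}" using maps_nonempty by blast
    have "p i \<le> (\<Sum>i=1..m. p i)"
      using i p_pos by (intro member_le_sum less_imp_le) auto
    then show ?thesis
      using p_min(1) p_min(2)[OF i] p_sum unfolding \<delta>_def by (intro power_le_one) auto
  qed
  \<comment> \<open>The drift constant, weighted by \<open>\<beta>\<close>, may consume at most half
    of the gain \<open>\<delta>\<close>.\<close>
  define \<beta> where "\<beta> = \<delta> / (4 * K + 1)"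
  have \<beta>: "\<beta> > 0" "2 * \<beta> * K \<le> \<delta> / 2"
    using \<open>\<delta> > 0\<close> K by (auto simp: \<beta>_def field_simps)
  define \<kappa>' where "\<kappa>' = (1 + \<kappa>) / 2"
  have \<kappa>': "\<kappa> < \<kappa>'" "\<kappa>' < 1" "0 < \<kappa>'" using \<kappa> by (auto simp: \<kappa>'_def)
  \<comment> \<open>The value at \<open>S = R\<close> of
    \<open>(2 + \<beta> * \<kappa>' * S) / (2 + \<beta> * S)\<close>, which decreases in
    \<open>S\<close> since \<open>\<kappa>' < 1\<close>; hence the worst factor over
    \<open>S \<ge> R\<close>.\<close>
  define r where "r = (2 + \<beta> * \<kappa>' * R) / (2 + \<beta> * R)"
  have pos: "0 < \<beta> * R" using \<beta> R by simp
  have r: "r < 1" "r > \<kappa>'" "2 * (1 - r) = \<beta> * R * (r - \<kappa>')"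
  proof -
    have "\<beta> * \<kappa>' * R < \<beta> * R"
      using mult_strict_left_mono[OF \<kappa>'(2) pos] by (simp add: mult_ac)
    then show "r < 1" using pos by (simp add: r_def)
    show "r > \<kappa>'" using pos \<kappa>' by (simp add: r_def field_simps)
    have "r * (2 + \<beta> * R) = 2 + \<beta> * \<kappa>' * R" using pos by (simp add: r_def)
    then show "2 * (1 - r) = \<beta> * R * (r - \<kappa>')" by (simp add: algebra_simps)
  qed
  \<comment> \<open>\<open>r\<close> serves the regime of large weight. In the other one,
    \<open>2 - \<delta>\<close> plus the drift cost \<open>\<delta> / 2\<close> is
    \<open>2 * (1 - \<delta> / 4)\<close>.\<close>
  define \<theta> where "\<theta> = max r (1 - \<delta> / 4)"
  have \<theta>: "0 < \<theta>" "\<theta> < 1" "r \<le> \<theta>" "1 - \<delta> / 4 \<le> \<theta>" "\<kappa> \<le> \<theta>"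
    using r \<kappa>' \<open>\<delta> > 0\<close> by (auto simp: \<theta>_def)
  have "(U ^^ N) h y - (U ^^ N) h x \<le> \<theta> * A * (2 + \<beta> * V x + \<beta> * V y)"
    if A: "A \<ge> 0" and h: "mono_on {0<..<1} h"
      and osc: "\<And>x y. 0 < x \<Longrightarrow> x \<le> y \<Longrightarrow> y < 1 \<Longrightarrow> h y - h x \<le> A * (2 + \<beta> * V x + \<beta> * V y)"
      and xy: "0 < x" "x \<le> y" "y < 1" for h A x y
  proof -
    define S where "S = V x + V y"
    have S: "V x \<le> S" "V y \<le> S" "0 \<le> S"
      using V[of x] V[of y] xy by (auto simp: S_def)
    \<comment> \<open>As \<open>N \<ge> 1\<close>, a block contracts \<open>V\<close> at least as
      much as one step; the choice of \<open>R\<close> relies on the single-step rate only.\<close>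
    have "\<kappa> ^ N \<le> \<kappa>"
      using power_decreasing[of 1 N \<kappa>] N(1) \<kappa> by simp
    have UV: "(U ^^ N) V z \<le> \<kappa> * V z + K" if z: "z \<in> {0<..<1}" for z
      using U_pow_drift[of \<kappa> V K z N] \<kappa> drift K z mult_right_mono[OF \<open>\<kappa> ^ N \<le> \<kappa>\<close> V[OF z]] by force
    have US: "\<beta> * (U ^^ N) V x + \<beta> * (U ^^ N) V y \<le> \<beta> * \<kappa> * S + 2 * \<beta> * K"
    proof -
      have "\<beta> * ((U ^^ N) V x + (U ^^ N) V y) \<le> \<beta> * (\<kappa> * S + 2 * K)"
        using UV[of x] UV[of y] xy \<beta>(1) by (intro mult_left_mono) (auto simp: S_def algebra_simps)
      then show ?thesis by (simp add: algebra_simps)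
    qed
    have bound: "?thesis" if "\<And>D. D = \<beta> * (U ^^ N) V x + \<beta> * (U ^^ N) V y \<Longrightarrow> c + D \<le> \<theta> * (2 + \<beta> * S)"
      "(U ^^ N) h y - (U ^^ N) h x \<le> A * (c + \<beta> * (U ^^ N) V x + \<beta> * (U ^^ N) V y)" for c
    proof -
      note that(2)
      also have "A * (c + \<beta> * (U ^^ N) V x + \<beta> * (U ^^ N) V y) \<le> A * (\<theta> * (2 + \<beta> * S))"
        using that(1)[OF refl] A by (intro mult_left_mono) auto
      finally show ?thesis by (simp add: S_def algebra_simps)
    qed
    have est1: "(U ^^ N) h y - (U ^^ N) h x \<le> A * (2 + \<beta> * (U ^^ N) V x + \<beta> * (U ^^ N) V y)"
      using \<beta>(1) by (intro splitting_estimate(1) A V osc h xy) auto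
    show ?thesis
    proof (cases "S \<ge> R")
      case True
      have "(1 - \<kappa>) / 2 * R \<le> (1 - \<kappa>) / 2 * S"
        using True \<kappa> by (intro mult_left_mono) auto
      then have "\<beta> * (2 * K) \<le> \<beta> * ((1 - \<kappa>) / 2 * S)"
        using R(2) \<beta>(1) by (intro mult_left_mono) auto
      then have "\<beta> * \<kappa> * S + 2 * \<beta> * K \<le> \<beta> * \<kappa>' * S"
        by (simp add: \<kappa>'_def field_simps)
      moreover have "2 * (1 - r) \<le> \<beta> * S * (r - \<kappa>')"
        unfolding r(3) using True \<beta>(1) r(2) by (intro mult_right_mono mult_left_mono) auto
      moreover have "r * (2 + \<beta> * S) \<le> \<theta> * (2 + \<beta> * S)"
        using \<theta>(3) \<beta>(1) S(3) by (intro mult_right_mono) auto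
      ultimately have "2 + (\<beta> * \<kappa> * S + 2 * \<beta> * K) \<le> \<theta> * (2 + \<beta> * S)"
        by (simp add: algebra_simps)
      then show ?thesis
        using US by (intro bound[OF _ est1]) linarith
    next
      case False
      then have "a \<le> x" "y \<le> b"
        using ab(3)[of x] ab(3)[of y] S xy by auto
      then have cross: "(down ^^ N) y \<le> 1/2" "1/2 \<le> (up ^^ N) x"
        using N xy by auto
      have "\<beta> * S * \<kappa> \<le> \<beta> * S * \<theta>"
        using \<theta>(5) \<beta>(1) S(3) by (intro mult_left_mono) auto
      then have "(2 - \<delta>) + (\<beta> * \<kappa> * S + 2 * \<beta> * K) \<le> \<theta> * (2 + \<beta> * S)"
        using \<beta>(2) \<theta>(4) by (simp add: algebra_simps)
      moreover have "(U ^^ N) h y - (U ^^ N) h x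
          \<le> A * (2 - \<delta> + \<beta> * (U ^^ N) V x + \<beta> * (U ^^ N) V y)"
        unfolding \<delta>_def using \<beta>(1) by (intro splitting_estimate(2) A V osc h xy cross) auto
      ultimately show ?thesis
        using US by (intro bound[of "2 - \<delta>"]) linarith
    qed
  qed
  note contraction = this
  show ?thesis
  proof (rule exI[of _ N], rule exI[of _ \<beta>], rule exI[of _ \<theta>], intro conjI allI impI)
    fix h and A x y :: real
    assume "0 \<le> A" "mono_on {0<..<1} h"
      and "\<forall>x y. 0 < x \<longrightarrow> x \<le> y \<longrightarrow> y < 1 \<longrightarrow> h y - h x \<le> A * (2 + \<beta> * V x + \<beta> * V y)"
      and "0 < x" "x \<le> y" "y < 1"
    then show "(U ^^ N) h y - (U ^^ N) h x \<le> \<theta> * A * (2 + \<beta> * V x + \<beta> * V y)"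
      by (intro contraction) simp_all
  qed fact+
qed

section \<open>Exponential decay for iterates of the identity\<close>

lemma U_pow_le:
  assumes "x \<in> {0<..<1}" and "\<And>z. z \<in> {0<..<1} \<Longrightarrow> \<phi> z \<le> \<psi> z"
  shows "(U ^^ n) \<phi> x \<le> (U ^^ n) \<psi> x"
  using assms(1) by (induction n arbitrary: x) (auto intro!: U_le assms(2))

lemma U_pow_const: "(U ^^ n) (\<lambda>_. c) x = c"
proof (induction n arbitrary: x)
  case (Suc n)
  then have "(U ^^ n) (\<lambda>_. c) = (\<lambda>_. c)" by blast
  then show ?case by (simp add: U_const)
qed simp

lemma U_pow_mono_on:
  assumes "mono_on {0<..<1} h"
  shows "mono_on {0<..<1} ((U ^^ n) h)"
proof (induction n)
  case (Suc n)
  show ?case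
  proof (rule mono_onI)
    fix x y :: real assume xy: "x \<in> {0<..<1}" "y \<in> {0<..<1}" "x \<le> y"
    have "U ((U ^^ n) h) x \<le> U ((U ^^ n) h) y"
      unfolding markov_op_def[of m p f "(U ^^ n) h"]
    proof (intro sum_mono mult_left_mono)
      fix i assume i: "i \<in> {1..m}"
      show "(U ^^ n) h (f i x) \<le> (U ^^ n) h (f i y)"
        using xy by (intro mono_onD[OF Suc] f_open[OF i] f_mono[OF i]) auto
      show "0 \<le> p i" using p_pos[OF i] by simp
    qed
    then show "(U ^^ Suc n) h x \<le> (U ^^ Suc n) h y" by simp
  qed
qed (use assms in simp)

text \<open>Under a common word of maps the order of the points persists, so after the Lipschitz
  bound at time 0 the distances are plain differences. Their average is the oscillation of the
  iterated identity.\<close>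

lemma U_pow_diff_le_identity:
  assumes Lip: "\<And>x y. x \<in> {0<..<1} \<Longrightarrow> y \<in> {0<..<1} \<Longrightarrow> \<bar>\<phi> x - \<phi> y\<bar> \<le> L * \<bar>x - y\<bar>"
    and xy: "0 < x" "x \<le> y" "y < 1"
  shows "\<bar>(U ^^ n) \<phi> x - (U ^^ n) \<phi> y\<bar> \<le> L * ((U ^^ n) (\<lambda>x. x) y - (U ^^ n) (\<lambda>x. x) x)"
  using xy
proof (induction n arbitrary: x y)
  case 0
  then show ?case using Lip[of x y] by simp
next
  case (Suc n)
  have "\<bar>(U ^^ Suc n) \<phi> x - (U ^^ Suc n) \<phi> y\<bar>
    = \<bar>\<Sum>i=1..m. p i * ((U ^^ n) \<phi> (f i x) - (U ^^ n) \<phi> (f i y))\<bar>"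
    by (simp add: markov_op_def sum_subtractf right_diff_distrib)
  also have "\<dots> \<le> (\<Sum>i=1..m. p i * (L * ((U ^^ n) (\<lambda>x. x) (f i y) - (U ^^ n) (\<lambda>x. x) (f i x))))"
  proof (intro order_trans[OF sum_abs] sum_mono)
    fix i assume i: "i \<in> {1..m}"
    have "\<bar>(U ^^ n) \<phi> (f i x) - (U ^^ n) \<phi> (f i y)\<bar>
      \<le> L * ((U ^^ n) (\<lambda>x. x) (f i y) - (U ^^ n) (\<lambda>x. x) (f i x))"
      using f_open[OF i, of x] f_open[OF i, of y] f_mono[OF i, of x y] Suc.prems
      by (intro Suc.IH) auto
    then show "\<bar>p i * ((U ^^ n) \<phi> (f i x) - (U ^^ n) \<phi> (f i y))\<bar>
      \<le> p i * (L * ((U ^^ n) (\<lambda>x. x) (f i y) - (U ^^ n) (\<lambda>x. x) (f i x)))"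
      using p_pos[OF i] by (simp add: abs_mult)
  qed
  also have "\<dots> = L * ((U ^^ Suc n) (\<lambda>x. x) y - (U ^^ Suc n) (\<lambda>x. x) x)"
    by (simp add: markov_op_def sum_subtractf right_diff_distrib sum_distrib_left mult_ac)
  finally show ?case .
qed

text \<open>The contraction acts on blocks of \<open>N\<close> steps and applies repeatedly because
  iterates of an increasing function are increasing. An arbitrary time is a number of full blocks
  plus a remainder.\<close>

lemma identity_oscillation_decay:
  assumes A2: "\<And>x. x \<in> {0<..<1} \<Longrightarrow> \<exists>i\<in>{1..m}. \<exists>j\<in>{1..m}. f i x < x \<and> x < f j x"
    and \<kappa>: "0 < \<kappa>" "\<kappa> < 1" and K: "K \<ge> 0"
    and V: "\<And>x. x \<in> {0<..<1} \<Longrightarrow> V x \<ge> 0"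
    and drift: "\<And>x. x \<in> {0<..<1} \<Longrightarrow> U V x \<le> \<kappa> * V x + K * (1 - \<kappa>)"
    and sublevel: "\<And>R. R > 0 \<Longrightarrow> \<exists>a\<in>{0<..<1}. \<exists>b\<in>{0<..<1}. \<forall>x\<in>{0<..<1}. V x \<le> R \<longrightarrow> a \<le> x \<and> x \<le> b"
  shows "\<exists>q C \<beta>. 0 < q \<and> q < 1 \<and> C \<ge> 0 \<and> \<beta> > 0 \<and> (\<forall>n x y. 0 < x \<longrightarrow> x \<le> y \<longrightarrow> y < 1 \<longrightarrow>
    (U ^^ n) (\<lambda>x. x) y - (U ^^ n) (\<lambda>x. x) x \<le> C * q ^ n * (2 + \<beta> * V x + \<beta> * V y))"
proof -
  obtain N \<beta> \<theta> where N: "N \<ge> 1" and \<beta>: "\<beta> > 0" and \<theta>: "0 < \<theta>" "\<theta> < 1"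
    and contr: "\<And>h A x y. A \<ge> 0 \<Longrightarrow> mono_on {0<..<1} h \<Longrightarrow>
      (\<And>x y. 0 < x \<Longrightarrow> x \<le> y \<Longrightarrow> y < 1 \<Longrightarrow> h y - h x \<le> A * (2 + \<beta> * V x + \<beta> * V y)) \<Longrightarrow>
      0 < x \<Longrightarrow> x \<le> y \<Longrightarrow> y < 1 \<Longrightarrow>
      (U ^^ N) h y - (U ^^ N) h x \<le> \<theta> * A * (2 + \<beta> * V x + \<beta> * V y)"
    using weighted_oscillation_contraction[OF A2 \<kappa> K V drift sublevel] by metis
  have id_mono: "mono_on {0<..<1} (\<lambda>x::real. x)"
    by (intro mono_onI)
  \<comment> \<open>Iterates of the identity keep values in the unit interval and the weight is at
    least 2, so amplitude 1 works for every remainder \<open>r\<close>.\<close>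
  have base: "(U ^^ r) (\<lambda>x. x) y - (U ^^ r) (\<lambda>x. x) x \<le> 1 * (2 + \<beta> * V x + \<beta> * V y)"
    if xy: "0 < x" "x \<le> y" "y < 1" for r x y
  proof -
    have "(U ^^ r) (\<lambda>x. x) y \<le> 1" "0 \<le> (U ^^ r) (\<lambda>x. x) x"
      using U_pow_le[of y "\<lambda>x. x" "\<lambda>_. 1" r] U_pow_le[of x "\<lambda>_. 0" "\<lambda>x. x" r] xy
      by (simp_all add: U_pow_const)
    moreover have "\<beta> * V x \<ge> 0" "\<beta> * V y \<ge> 0"
      using V[of x] V[of y] \<beta> xy by simp_all
    ultimately show ?thesis by simp
  qed
  have blocks: "(U ^^ (N * k + r)) (\<lambda>x. x) y - (U ^^ (N * k + r)) (\<lambda>x. x) x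
      \<le> \<theta> ^ k * (2 + \<beta> * V x + \<beta> * V y)"
    if "0 < x" "x \<le> y" "y < 1" for k r x y
    using that
  proof (induction k arbitrary: x y)
    case (Suc k)
    \<comment> \<open>The new block is the outer one, so \<open>contr\<close> is applied to the
      earlier iterate with amplitude \<open>\<theta> ^ k\<close>.\<close>
    have "(U ^^ (N * Suc k + r)) = (\<lambda>h. (U ^^ N) ((U ^^ (N * k + r)) h))"
      by (simp add: funpow_add comp_def)
    then show ?case
      using contr[of "\<theta> ^ k" "(U ^^ (N * k + r)) (\<lambda>x. x)", OF _ U_pow_mono_on[OF id_mono] Suc.IH Suc.prems]
        \<theta> by simp
  qed (use base in simp)
  define q where "q = \<theta> powr (1 / real N)"
  have q: "0 < q" "q < 1" "q ^ N = \<theta>"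
  proof -
    show "0 < q" using \<theta> by (simp add: q_def)
    show "q < 1" unfolding q_def using \<theta> N powr_less_mono2[of "1 / real N" \<theta> 1] by simp
    show "q ^ N = \<theta>"
      using \<theta> N by (simp add: q_def powr_powr flip: powr_realpow)
  qed
  \<comment> \<open>The factor \<open>1 / \<theta>\<close> pays for the incomplete block: rounding
    \<open>n\<close> up to \<open>N * (k + 1)\<close> costs one extra power of
    \<open>\<theta> = q ^ N\<close>.\<close>
  have "(U ^^ n) (\<lambda>x. x) y - (U ^^ n) (\<lambda>x. x) x \<le> 1 / \<theta> * q ^ n * (2 + \<beta> * V x + \<beta> * V y)"
    if xy: "0 < x" "x \<le> y" "y < 1" for n x y
  proof -
    define k r where "k = n div N" and "r = n mod N"
    have n: "N * k + r = n" by (simp add: k_def r_def)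
    have "r < N" using N by (simp add: r_def)
    then have "n \<le> N * (k + 1)" using n by simp
    then have "q ^ (N * (k + 1)) \<le> q ^ n"
      using q by (intro power_decreasing) auto
    then have "\<theta> ^ (k + 1) \<le> q ^ n"
      by (simp only: power_mult q(3))
    then have "\<theta> ^ k \<le> 1 / \<theta> * q ^ n"
      using \<theta> by (simp add: field_simps)
    moreover have "0 \<le> 2 + \<beta> * V x + \<beta> * V y"
      using V[of x] V[of y] \<beta> xy by simp
    ultimately have "\<theta> ^ k * (2 + \<beta> * V x + \<beta> * V y) \<le> 1 / \<theta> * q ^ n * (2 + \<beta> * V x + \<beta> * V y)"
      by (intro mult_right_mono)
    then show ?thesis
      using blocks[OF xy, of k r] n by simp
  qed
  note osc = this
  show ?thesis
  proof (rule exI[of _ q], rule exI[of _ "1 / \<theta>"], rule exI[of _ \<beta>], intro conjI allI impI)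
    show "0 \<le> 1 / \<theta>" using \<theta> by simp
  qed (fact q \<beta> | rule osc; assumption)+
qed

end

section \<open>Integration against a stationary measure\<close>

locale stationary_ifs = increasing_ifs + prob_space \<mu> for \<mu> :: "real measure" +
  assumes sets_\<mu>: "sets \<mu> = sets (restrict_space borel I01)"
    and stat: "stationary m p f \<mu>"
begin

section \<open>Measurability and invariance of integrals\<close>

lemma space_\<mu>: "space \<mu> = I01"
  using sets_eq_imp_space_eq[OF sets_\<mu>] by (simp add: space_restrict_space)

lemma borel_measurable_cont: "continuous_on I01 g \<Longrightarrow> g \<in> borel_measurable \<mu>"
  using borel_measurable_continuous_on_restrict[of I01 g] measurable_cong_sets[OF sets_\<mu> refl] by blast

lemma f_measurable [measurable]: "i \<in> {1..m} \<Longrightarrow> f i \<in> measurable \<mu> \<mu>"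
  unfolding measurable_cong_sets[OF refl sets_\<mu>]
  using f_closed[of i] borel_measurable_cont[OF f_cont, of i]
  by (intro measurable_restrict_space2) (auto simp: space_\<mu>)

lemma U_measurable:
  assumes "g \<in> borel_measurable \<mu>"
  shows "U g \<in> borel_measurable \<mu>"
proof -
  have "(\<lambda>x. g (f i x)) \<in> borel_measurable \<mu>" if "i \<in> {1..m}" for i
    using f_measurable[OF that] assms by measurable
  then have "(\<lambda>x. \<Sum>i=1..m. p i * g (f i x)) \<in> borel_measurable \<mu>"
    by (intro borel_measurable_sum borel_measurable_times borel_measurable_const) auto
  then show ?thesis by (simp add: markov_op_def[abs_def])
qed

text \<open>Stationarity concerns measures of sets; induction over indicators, multiples, sums and
  monotone limits carries it to nonnegative functions, with no integrability to check.\<close>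

lemma nn_integral_stationary:
  assumes "g \<in> borel_measurable \<mu>"
  shows "(\<Sum>i=1..m. ennreal (p i) * (\<integral>\<^sup>+x. g (f i x) \<partial>\<mu>)) = (\<integral>\<^sup>+x. g x \<partial>\<mu>)"
  using assms
proof (induction rule: borel_measurable_induct)
  case (cong u v)
  have "(\<integral>\<^sup>+x. u (f i x) \<partial>\<mu>) = (\<integral>\<^sup>+x. v (f i x) \<partial>\<mu>)" if "i \<in> {1..m}" for i
    using cong(3) f_closed[OF that] by (intro nn_integral_cong) (simp add: space_\<mu>)
  moreover have "integral\<^sup>N \<mu> u = integral\<^sup>N \<mu> v"
    using cong(3) by (intro nn_integral_cong)
  ultimately show ?case using cong(4) by simp
next
  case (set A)
  have "(\<integral>\<^sup>+x. indicator A (f i x) \<partial>\<mu>) = ennreal (measure \<mu> (f i -` A \<inter> I01))" if i: "i \<in> {1..m}" for i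
  proof -
    have "(\<integral>\<^sup>+x. indicator A (f i x) \<partial>\<mu>) = (\<integral>\<^sup>+x. indicator (f i -` A \<inter> space \<mu>) x \<partial>\<mu>)"
      by (intro nn_integral_cong) (auto split: split_indicator)
    then show ?thesis
      using measurable_sets[OF f_measurable[OF i] set] by (simp add: emeasure_eq_measure space_\<mu>)
  qed
  then have "(\<Sum>i=1..m. ennreal (p i) * (\<integral>\<^sup>+x. indicator A (f i x) \<partial>\<mu>))
    = (\<Sum>i=1..m. ennreal (p i * measure \<mu> (f i -` A \<inter> I01)))"
    using p_pos by (intro sum.cong refl) (simp add: ennreal_mult less_imp_le)
  also have "\<dots> = ennreal (transfer_op m p f \<mu> A)"
    unfolding transfer_op_def using p_pos
    by (intro sum_ennreal mult_nonneg_nonneg) (auto intro: less_imp_le)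
  also have "\<dots> = (\<integral>\<^sup>+x. indicator A x \<partial>\<mu>)"
    using stat set by (simp add: stationary_def emeasure_eq_measure)
  finally show ?case .
next
  case (mult u c)
  have "(\<integral>\<^sup>+x. c * u (f i x) \<partial>\<mu>) = c * (\<integral>\<^sup>+x. u (f i x) \<partial>\<mu>)" if i: "i \<in> {1..m}" for i
    using measurable_compose[OF f_measurable[OF i] mult(2)] by (rule nn_integral_cmult)
  then have "(\<Sum>i=1..m. ennreal (p i) * (\<integral>\<^sup>+x. c * u (f i x) \<partial>\<mu>))
     = c * (\<Sum>i=1..m. ennreal (p i) * (\<integral>\<^sup>+x. u (f i x) \<partial>\<mu>))"
    unfolding sum_distrib_left by (intro sum.cong) (auto simp: mult_ac)
  then show ?case using mult by (simp add: nn_integral_cmult)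
next
  case (add u v)
  have "(\<integral>\<^sup>+x. v (f i x) + u (f i x) \<partial>\<mu>) = (\<integral>\<^sup>+x. v (f i x) \<partial>\<mu>) + (\<integral>\<^sup>+x. u (f i x) \<partial>\<mu>)"
    if i: "i \<in> {1..m}" for i
    by (intro nn_integral_add measurable_compose[OF f_measurable[OF i]])
      (fact \<open>v \<in> borel_measurable \<mu>\<close> \<open>u \<in> borel_measurable \<mu>\<close>)+
  then have "(\<Sum>i=1..m. ennreal (p i) * (\<integral>\<^sup>+x. v (f i x) + u (f i x) \<partial>\<mu>))
     = (\<Sum>i=1..m. ennreal (p i) * (\<integral>\<^sup>+x. v (f i x) \<partial>\<mu>)) + (\<Sum>i=1..m. ennreal (p i) * (\<integral>\<^sup>+x. u (f i x) \<partial>\<mu>))"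
    unfolding sum.distrib[symmetric] by (intro sum.cong) (auto simp: distrib_left)
  then show ?case using add by (simp add: nn_integral_add)
next
  case (seq s)
  note [measurable] = seq(1)
  \<comment> \<open>Stated for a general \<open>h\<close>, since monotone convergence is used both
    with \<open>h = f i\<close> and with the identity.\<close>
  have lim: "(\<lambda>n. \<integral>\<^sup>+x. s n (h x) \<partial>\<mu>) \<longlonglongrightarrow> (\<integral>\<^sup>+x. (SUP n. s n) (h x) \<partial>\<mu>)"
    if [measurable]: "h \<in> measurable \<mu> \<mu>" for h
  proof -
    have inc: "incseq (\<lambda>n x. s n (h x))"
      using seq(3) by (auto simp: incseq_def le_fun_def)
    have "(\<integral>\<^sup>+x. (SUP n. s n) (h x) \<partial>\<mu>) = (SUP n. \<integral>\<^sup>+x. s n (h x) \<partial>\<mu>)"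
      unfolding SUP_apply using inc by (intro nn_integral_monotone_convergence_SUP) measurable
    moreover have "incseq (\<lambda>n. \<integral>\<^sup>+x. s n (h x) \<partial>\<mu>)"
      using inc by (auto simp: incseq_def le_fun_def intro!: nn_integral_mono)
    ultimately show ?thesis
      using LIMSEQ_SUP by metis
  qed
  have "(\<lambda>n. \<Sum>i=1..m. ennreal (p i) * (\<integral>\<^sup>+x. s n (f i x) \<partial>\<mu>)) \<longlonglongrightarrow>
     (\<Sum>i=1..m. ennreal (p i) * (\<integral>\<^sup>+x. (SUP n. s n) (f i x) \<partial>\<mu>))"
    by (intro tendsto_sum ennreal_tendsto_cmult lim f_measurable) auto
  then have "(\<lambda>n. \<integral>\<^sup>+x. s n x \<partial>\<mu>) \<longlonglongrightarrow>
     (\<Sum>i=1..m. ennreal (p i) * (\<integral>\<^sup>+x. (SUP n. s n) (f i x) \<partial>\<mu>))"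
    by (simp only: seq.IH)
  then show ?case
    using lim[of "\<lambda>x. x"] LIMSEQ_unique by auto
qed

text \<open>The bound is explicit because \<open>U\<close> preserves it, which makes all iterates
  integrable with respect to the probability measure.\<close>

definition bounded_obs :: "(real \<Rightarrow> real) \<Rightarrow> real \<Rightarrow> bool"
  where "bounded_obs g B \<longleftrightarrow> g \<in> borel_measurable \<mu> \<and> (\<forall>x\<in>I01. \<bar>g x\<bar> \<le> B)"

lemma bounded_obs_integrable: "bounded_obs g B \<Longrightarrow> integrable \<mu> g"
  by (rule integrable_const_bound[of _ B]) (auto simp: bounded_obs_def space_\<mu>)

lemma bounded_obs_U:
  assumes "bounded_obs g B"
  shows "bounded_obs (U g) B"
proof -
  have "\<bar>U g x\<bar> \<le> B" if x: "x \<in> I01" for x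
  proof -
    have "\<bar>U g x\<bar> \<le> (\<Sum>i=1..m. p i * B)"
      unfolding markov_op_def
    proof (intro order_trans[OF sum_abs] sum_mono)
      fix i assume i: "i \<in> {1..m}"
      show "\<bar>p i * g (f i x)\<bar> \<le> p i * B"
        using assms f_closed[OF i x] p_pos[OF i] by (simp add: bounded_obs_def abs_mult)
    qed
    then show ?thesis using p_sum by (simp flip: sum_distrib_right)
  qed
  then show ?thesis using assms U_measurable by (simp add: bounded_obs_def)
qed

lemma integral_U:
  assumes g: "bounded_obs g B"
  shows "(\<integral>x. U g x \<partial>\<mu>) = (\<integral>x. g x \<partial>\<mu>)"
proof -
  \<comment> \<open>Adding the bound \<open>B\<close> makes the function nonnegative, so the
    extended integral applies; the factors \<open>1\<close> match \<open>U_lin\<close>.\<close>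
  define h where "h x = 1 * g x + B * 1" for x
  have h_meas [measurable]: "h \<in> borel_measurable \<mu>"
    using g unfolding h_def bounded_obs_def by (intro borel_measurable_add borel_measurable_times) auto
  have h_nonneg: "h x \<ge> 0" if "x \<in> I01" for x
    using g that unfolding h_def bounded_obs_def by fastforce
  have Uh: "U h = (\<lambda>x. U g x + B)"
    using U_lin[of 1 g B "\<lambda>_. 1"] by (auto simp: h_def[abs_def] U_const)
  have "(\<integral>\<^sup>+x. ennreal (U h x) \<partial>\<mu>) = (\<integral>\<^sup>+x. (\<Sum>i=1..m. ennreal (p i) * ennreal (h (f i x))) \<partial>\<mu>)"
  proof (rule nn_integral_cong)
    fix x assume x: "x \<in> space \<mu>"
    have "ennreal (U h x) = (\<Sum>i=1..m. ennreal (p i * h (f i x)))"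
      unfolding markov_op_def
    proof (rule sum_ennreal[symmetric])
      fix i assume i: "i \<in> {1..m}"
      show "0 \<le> p i * h (f i x)"
        using h_nonneg[OF f_closed[OF i]] p_pos[OF i] x by (simp add: space_\<mu>)
    qed
    also have "\<dots> = (\<Sum>i=1..m. ennreal (p i) * ennreal (h (f i x)))"
      using p_pos by (intro sum.cong refl ennreal_mult') (auto intro: less_imp_le)
    finally show "ennreal (U h x) = (\<Sum>i=1..m. ennreal (p i) * ennreal (h (f i x)))" .
  qed
  also have "\<dots> = (\<Sum>i=1..m. (\<integral>\<^sup>+x. ennreal (p i) * ennreal (h (f i x)) \<partial>\<mu>))"
    by (intro nn_integral_sum) measurable
  also have "\<dots> = (\<Sum>i=1..m. ennreal (p i) * (\<integral>\<^sup>+x. ennreal (h (f i x)) \<partial>\<mu>))"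
    by (intro sum.cong refl nn_integral_cmult) measurable
  also have "\<dots> = (\<integral>\<^sup>+x. ennreal (h x) \<partial>\<mu>)"
    by (rule nn_integral_stationary) measurable
  finally have eq: "(\<integral>\<^sup>+x. ennreal (U h x) \<partial>\<mu>) = (\<integral>\<^sup>+x. ennreal (h x) \<partial>\<mu>)" .
  have Uh_nonneg: "U h x \<ge> 0" if "x \<in> I01" for x
    unfolding markov_op_def using h_nonneg f_closed that p_pos
    by (intro sum_nonneg mult_nonneg_nonneg) (auto intro: less_imp_le)
  have "(\<integral>x. U h x \<partial>\<mu>) = (\<integral>x. h x \<partial>\<mu>)"
    using eq Uh_nonneg h_nonneg U_measurable[OF h_meas] h_meas
    by (subst (1 2) integral_eq_nn_integral) (auto simp: space_\<mu>)
  moreover have "(\<integral>x. U h x \<partial>\<mu>) = (\<integral>x. U g x \<partial>\<mu>) + B"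
    using bounded_obs_integrable[OF bounded_obs_U[OF g]] by (simp add: Uh prob_space)
  moreover have "(\<integral>x. h x \<partial>\<mu>) = (\<integral>x. g x \<partial>\<mu>) + B"
    using bounded_obs_integrable[OF g] by (simp add: h_def prob_space)
  ultimately show ?thesis by simp
qed

lemma bounded_obs_U_pow: "bounded_obs g B \<Longrightarrow> bounded_obs ((U ^^ n) g) B"
  by (induction n) (auto intro: bounded_obs_U)

lemma integral_U_pow: "bounded_obs g B \<Longrightarrow> (\<integral>x. (U ^^ n) g x \<partial>\<mu>) = (\<integral>x. g x \<partial>\<mu>)"
  by (induction n) (auto simp: integral_U[OF bounded_obs_U_pow])


text \<open>Invariance of the integral is available only for bounded functions, so \<open>V\<close>
  is truncated at \<open>M\<close>. The truncation is replaced by its \<open>n\<close>-th iterate,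
  which is at most \<open>min M (\<kappa> ^ n * V x + K)\<close>; letting \<open>n\<close> grow
  bounds its integral by \<open>K\<close> uniformly in \<open>M\<close>.\<close>

lemma integrable_drift_function:
  assumes interior: "AE x in \<mu>. x \<in> {0<..<1}"
    and \<kappa>: "0 < \<kappa>" "\<kappa> < 1" and K: "K \<ge> 0"
    and V_meas [measurable]: "V \<in> borel_measurable \<mu>" and V: "\<And>x. V x \<ge> 0"
    and drift: "\<And>x. x \<in> {0<..<1} \<Longrightarrow> U V x \<le> \<kappa> * V x + K * (1 - \<kappa>)"
  shows "integrable \<mu> V"
proof -
  have trunc: "(\<integral>x. min (V x) M \<partial>\<mu>) \<le> K" if M: "M \<ge> 0" for M
  proof -
    define g where "g x = min (V x) M" for x
    have g: "bounded_obs g M"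
      using V M by (auto simp: bounded_obs_def g_def[abs_def] abs_le_iff min_def
        intro: order_trans[of _ 0])
    have "(\<integral>x. g x \<partial>\<mu>) \<le> (\<integral>x. min M (\<kappa> ^ n * V x + K) \<partial>\<mu>)" for n
    proof -
      have "(\<integral>x. (U ^^ n) g x \<partial>\<mu>) \<le> (\<integral>x. min M (\<kappa> ^ n * V x + K) \<partial>\<mu>)"
      proof (rule integral_mono_AE)
        show "integrable \<mu> ((U ^^ n) g)"
          by (rule bounded_obs_integrable[OF bounded_obs_U_pow[OF g]])
        show "integrable \<mu> (\<lambda>x. min M (\<kappa> ^ n * V x + K))"
          using V K \<kappa> M by (intro integrable_const_bound[of _ M]) auto
        have le: "(U ^^ n) g x \<le> min M (\<kappa> ^ n * V x + K)" if x: "x \<in> {0<..<1}" for x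
          using U_pow_le[OF x, of g "\<lambda>_. M" n] U_pow_le[OF x, of g V n]
            U_pow_drift[OF _ _ drift K x, of n] \<kappa>
          by (simp add: g_def[abs_def] U_pow_const)
        show "AE x in \<mu>. (U ^^ n) g x \<le> min M (\<kappa> ^ n * V x + K)"
          by (rule eventually_mono[OF interior le])
      qed
      then show ?thesis
        by (simp add: integral_U_pow[OF g])
    qed
    moreover have "(\<lambda>n. \<integral>x. min M (\<kappa> ^ n * V x + K) \<partial>\<mu>) \<longlonglongrightarrow> (\<integral>x. min M K \<partial>\<mu>)"
    proof (rule integral_dominated_convergence[where w = "\<lambda>_. M"])
      show "AE x in \<mu>. (\<lambda>n. min M (\<kappa> ^ n * V x + K)) \<longlonglongrightarrow> min M K"
      proof (rule AE_I2)
        fix x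
        have "(\<lambda>n. min M (\<kappa> ^ n * V x + K)) \<longlonglongrightarrow> min M (0 * V x + K)"
          using \<kappa> by (intro tendsto_intros LIMSEQ_realpow_zero) auto
        then show "(\<lambda>n. min M (\<kappa> ^ n * V x + K)) \<longlonglongrightarrow> min M K" by simp
      qed
      show "AE x in \<mu>. norm (min M (\<kappa> ^ n * V x + K)) \<le> M" for n
        using V K \<kappa> M by (intro AE_I2) auto
    qed auto
    ultimately have "(\<integral>x. g x \<partial>\<mu>) \<le> (\<integral>x. min M K \<partial>\<mu>)"
      using LIMSEQ_le_const by blast
    then show ?thesis by (simp add: g_def prob_space)
  qed
  \<comment> \<open>At each point the truncations at integer levels are eventually equal to
    \<open>V\<close>, so Fatou's lemma transfers the uniform bound \<open>K\<close>.\<close>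
  have "(\<integral>\<^sup>+x. ennreal (V x) \<partial>\<mu>) = (\<integral>\<^sup>+x. liminf (\<lambda>n. ennreal (min (V x) (real n))) \<partial>\<mu>)"
  proof (rule nn_integral_cong)
    fix x
    have "\<forall>\<^sub>F n in sequentially. ennreal (min (V x) (real n)) = ennreal (V x)"
      using eventually_ge_at_top[of "nat \<lceil>V x\<rceil>"] by eventually_elim (simp add: min_def nat_ceiling_le_eq)
    then have "(\<lambda>n. ennreal (min (V x) (real n))) \<longlonglongrightarrow> ennreal (V x)"
      by (rule tendsto_eventually)
    then show "ennreal (V x) = liminf (\<lambda>n. ennreal (min (V x) (real n)))"
      by (simp add: lim_imp_Liminf)
  qed
  also have "\<dots> \<le> liminf (\<lambda>n. \<integral>\<^sup>+x. ennreal (min (V x) (real n)) \<partial>\<mu>)"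
    by (rule nn_integral_liminf) measurable
  also have "\<dots> \<le> liminf (\<lambda>n. ennreal K)"
  proof (intro Liminf_mono always_eventually allI)
    fix n
    have "integrable \<mu> (\<lambda>x. min (V x) (real n))"
      using V by (intro integrable_const_bound[of _ "real n"]) (auto simp: min_def)
    then have "(\<integral>\<^sup>+x. ennreal (min (V x) (real n)) \<partial>\<mu>) = ennreal (\<integral>x. min (V x) (real n) \<partial>\<mu>)"
      using V by (intro nn_integral_eq_integral) auto
    then show "(\<integral>\<^sup>+x. ennreal (min (V x) (real n)) \<partial>\<mu>) \<le> ennreal K"
      using trunc[of "real n"] by (simp add: ennreal_leI)
  qed
  also have "\<dots> < \<infinity>"
    by (simp add: Liminf_const)
  finally show ?thesis
    using V by (intro integrableI_nonneg) auto
qed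

text \<open>The correlation is the integral of \<open>(u - I) * \<psi>\<close>, where
  \<open>u\<close> is the iterate of \<open>\<phi>\<close> and \<open>I\<close> its mean. Averaging
  the oscillation bound over \<open>y\<close> controls \<open>u x - I\<close>; integrating over
  \<open>x\<close> then produces the second copy of the integral of \<open>V\<close>.\<close>

lemma correlation_decay:
  assumes interior: "AE x in \<mu>. x \<in> {0<..<1}"
    and V_int: "integrable \<mu> V" and c: "c \<ge> 0"
    and osc: "\<And>x y. 0 < x \<Longrightarrow> x \<le> y \<Longrightarrow> y < 1 \<Longrightarrow>
      (U ^^ n) (\<lambda>x. x) y - (U ^^ n) (\<lambda>x. x) x \<le> c * (2 + \<beta> * V x + \<beta> * V y)"
    and \<phi>: "bounded_obs \<phi> B" and Lip: "\<And>x y. x \<in> I01 \<Longrightarrow> y \<in> I01 \<Longrightarrow> \<bar>\<phi> x - \<phi> y\<bar> \<le> L * \<bar>x - y\<bar>"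
    and L: "L \<ge> 0" and \<psi>: "bounded_obs \<psi> D"
  shows "\<bar>(\<integral>x. (U ^^ n) \<phi> x * \<psi> x \<partial>\<mu>) - (\<integral>x. \<phi> x \<partial>\<mu>) * (\<integral>x. \<psi> x \<partial>\<mu>)\<bar>
    \<le> L * D * c * (2 + 2 * \<beta> * (\<integral>x. V x \<partial>\<mu>))"
proof -
  define u where "u = (U ^^ n) \<phi>"
  define I where "I = (\<integral>x. \<phi> x \<partial>\<mu>)"
  define W where "W = (\<integral>x. V x \<partial>\<mu>)"
  have u: "bounded_obs u B" unfolding u_def by (rule bounded_obs_U_pow[OF \<phi>])
  note u_int = bounded_obs_integrable[OF u] and \<psi>_int = bounded_obs_integrable[OF \<psi>]
  have I: "I = (\<integral>x. u x \<partial>\<mu>)" unfolding I_def u_def by (simp add: integral_U_pow[OF \<phi>])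
  have u_osc: "\<bar>u x - u y\<bar> \<le> L * (c * (2 + \<beta> * V x + \<beta> * V y))"
    if "x \<in> {0<..<1}" "y \<in> {0<..<1}" for x y
    using that
  proof (induction x y rule: linorder_wlog)
    case (le x y)
    have "\<bar>u x - u y\<bar> \<le> L * ((U ^^ n) (\<lambda>x. x) y - (U ^^ n) (\<lambda>x. x) x)"
      unfolding u_def using le by (intro U_pow_diff_le_identity Lip) auto
    also have "\<dots> \<le> L * (c * (2 + \<beta> * V x + \<beta> * V y))"
      using le L by (intro mult_left_mono osc) auto
    finally show ?case .
  next
    case (sym x y)
    then show ?case by (simp add: abs_minus_commute add_ac)
  qed
  have dev: "\<bar>u x - I\<bar> \<le> L * (c * (2 + \<beta> * V x + \<beta> * W))" if x: "x \<in> {0<..<1}" for x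
  proof -
    have "\<bar>u x - I\<bar> = \<bar>\<integral>y. u x - u y \<partial>\<mu>\<bar>"
      using u_int by (simp add: I prob_space)
    also have "\<dots> \<le> (\<integral>y. \<bar>u x - u y\<bar> \<partial>\<mu>)"
      by (rule integral_abs_bound)
    also have "\<dots> \<le> (\<integral>y. L * (c * (2 + \<beta> * V x + \<beta> * V y)) \<partial>\<mu>)"
    proof (rule integral_mono_AE)
      show "AE y in \<mu>. \<bar>u x - u y\<bar> \<le> L * (c * (2 + \<beta> * V x + \<beta> * V y))"
        using interior by eventually_elim (rule u_osc[OF x])
    qed (use u_int V_int in auto)
    also have "\<dots> = L * (c * (2 + \<beta> * V x + \<beta> * W))"
      using V_int by (simp add: W_def prob_space)
    finally show ?thesis .
  qed
  have "bounded_obs (\<lambda>x. u x * \<psi> x) (B * D)"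
    using u \<psi> unfolding bounded_obs_def by (auto simp: abs_mult intro!: mult_mono order_trans[OF abs_ge_zero])
  note u\<psi>_int = bounded_obs_integrable[OF this]
  have "(\<integral>x. u x * \<psi> x \<partial>\<mu>) - I * (\<integral>x. \<psi> x \<partial>\<mu>) = (\<integral>x. (u x - I) * \<psi> x \<partial>\<mu>)"
    using u\<psi>_int \<psi>_int by (simp add: left_diff_distrib)
  then have "\<bar>(\<integral>x. u x * \<psi> x \<partial>\<mu>) - I * (\<integral>x. \<psi> x \<partial>\<mu>)\<bar> \<le> (\<integral>x. \<bar>(u x - I) * \<psi> x\<bar> \<partial>\<mu>)"
    by (simp only: integral_abs_bound)
  also have "\<dots> \<le> (\<integral>x. L * (c * (2 + \<beta> * V x + \<beta> * W)) * D \<partial>\<mu>)"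
  proof (rule integral_mono_AE)
    have le: "\<bar>(u x - I) * \<psi> x\<bar> \<le> L * (c * (2 + \<beta> * V x + \<beta> * W)) * D" if x: "x \<in> {0<..<1}" for x
    proof -
      have "\<bar>\<psi> x\<bar> \<le> D" using \<psi> x by (auto simp: bounded_obs_def)
      then show ?thesis
        unfolding abs_mult using dev[OF x] by (intro mult_mono) auto
    qed
    show "AE x in \<mu>. \<bar>(u x - I) * \<psi> x\<bar> \<le> L * (c * (2 + \<beta> * V x + \<beta> * W)) * D"
      by (rule eventually_mono[OF interior le])
    show "integrable \<mu> (\<lambda>x. \<bar>(u x - I) * \<psi> x\<bar>)"
      using u\<psi>_int \<psi>_int by (simp add: left_diff_distrib)
  qed (use V_int in auto)
  also have "\<dots> = L * D * c * (2 + 2 * \<beta> * W)"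
    using V_int by (simp add: W_def prob_space algebra_simps)
  finally show ?thesis unfolding u_def I_def W_def .
qed

end

section \<open>Diffeomorphisms of the unit interval\<close>

lemma has_deriv01:
  assumes "C2_01 f" "x \<in> I01"
  shows "(f has_real_derivative deriv01 f x) (at x within I01)"
  using assms vector_derivative_works
  unfolding C2_01_def deriv01_def differentiable_on_def has_real_derivative_iff_has_vector_derivative
  by blast

text \<open>The chain rule for the inverse composed with \<open>f\<close> excludes derivative zero,
  and difference quotients of an increasing function are nonnegative. Derivatives within the
  interval are unique even at its endpoints, as these are limit points.\<close>

lemma deriv01_pos:
  assumes f: "C2_diffeo_01 f" "strict_mono_on I01 f" and x: "x \<in> I01"
  shows "deriv01 f x > 0"
proof -
  have bij: "bij_betw f I01 I01" and C2: "C2_01 f" "C2_01 (inv_into I01 f)"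
    using f by (auto simp: C2_diffeo_01_def)
  have fx: "f x \<in> I01" and img: "f ` I01 = I01"
    using bij x by (auto simp: bij_betw_def)
  have nontrivial: "at x within I01 \<noteq> bot"
    using x by (simp add: trivial_limit_within)
  have "((inv_into I01 f \<circ> f) has_real_derivative deriv01 (inv_into I01 f) (f x) * deriv01 f x) (at x within I01)"
    using has_deriv01[OF C2(2) fx] has_deriv01[OF C2(1) x] by (intro DERIV_image_chain) (simp_all only: img)
  \<comment> \<open>The composition is the identity only on the unit interval, which suffices for a
    derivative within it.\<close>
  then have "((\<lambda>y. y) has_real_derivative deriv01 (inv_into I01 f) (f x) * deriv01 f x) (at x within I01)"
    using x bij_betw_inv_into_left[OF bij]
    by (subst (asm) has_field_derivative_cong_eventually[where g = "\<lambda>y. y"])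
      (auto simp: eventually_at_filter)
  moreover have "((\<lambda>y. y) has_real_derivative 1) (at x within I01)"
    by (rule DERIV_ident)
  ultimately have "deriv01 (inv_into I01 f) (f x) * deriv01 f x = 1"
    unfolding has_real_derivative_iff_has_vector_derivative
    by (rule vector_derivative_unique_within[OF nontrivial])
  then have "deriv01 f x \<noteq> 0" by auto
  moreover have "deriv01 f x \<ge> 0"
  proof (rule tendsto_lowerbound[OF _ _ nontrivial])
    show "((\<lambda>y. (f y - f x) / (y - x)) \<longlongrightarrow> deriv01 f x) (at x within I01)"
      using has_deriv01[OF C2(1) x] by (simp add: has_field_derivative_iff)
    have "0 \<le> (f y - f x) / (y - x)" if "y \<in> I01" for y
      using strict_mono_on_leD[OF f(2), of x y] strict_mono_on_leD[OF f(2), of y x] that x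
      by (cases "x \<le> y") (auto intro: divide_nonpos_nonpos)
    then show "\<forall>\<^sub>F y in at x within I01. 0 \<le> (f y - f x) / (y - x)"
      by (auto simp: eventually_at_filter)
  qed
  ultimately show ?thesis by simp
qed

lemma slope_at_0:
  assumes "(g has_real_derivative D) (at 0 within I01)" "g 0 = 0"
  shows "((\<lambda>x. g x / x) \<longlongrightarrow> D) (at_right 0)"
proof -
  have "((\<lambda>x. g x / x) \<longlongrightarrow> D) (at 0 within I01)"
    using assms by (simp add: has_field_derivative_iff)
  then show ?thesis
    by (simp add: at_within_Icc_at_right)
qed

text \<open>Conjugation by \<open>x \<mapsto> 1 - x\<close> moves the endpoint 1 to 0, and its two
  sign changes cancel in the derivative.\<close>

lemma slope_at_1:
  assumes "(g has_real_derivative D) (at 1 within I01)" "g 1 = 1"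
  shows "((\<lambda>x. (1 - g (1 - x)) / x) \<longlongrightarrow> D) (at_right 0)"
proof (rule slope_at_0)
  have "(\<lambda>x::real. 1 - x) ` I01 = I01"
    by (simp add: image_diff_atLeastAtMost)
  then have "((g \<circ> (\<lambda>x. 1 - x)) has_real_derivative D * - 1) (at 0 within I01)"
    using assms(1) by (intro DERIV_image_chain) (auto intro!: derivative_eq_intros)
  then show "((\<lambda>x. 1 - g (1 - x)) has_real_derivative D) (at 0 within I01)"
    by (auto simp: comp_def intro!: derivative_eq_intros)
qed (use assms in simp)

lemma increasing_ifs_diffeo:
  assumes "\<And>i. i \<in> {1..m} \<Longrightarrow> p i > 0" and "(\<Sum>i=1..m. p i) = 1"
    and A1: "\<And>i. i \<in> {1..m} \<Longrightarrow> C2_diffeo_01 (f i) \<and> strict_mono_on {0..1} (f i)"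
  shows "increasing_ifs m p f"
proof
  fix i assume i: "i \<in> {1..m}"
  then have mono: "strict_mono_on I01 (f i)" and bij: "bij_betw (f i) I01 I01" and "C2_01 (f i)"
    using A1 by (auto simp: C2_diffeo_01_def)
  then show "continuous_on I01 (f i)" "strict_mono_on I01 (f i)"
    using differentiable_imp_continuous_on by (auto simp: C2_01_def)
  have img: "f i ` I01 = I01" using bij by (simp add: bij_betw_def)
  \<comment> \<open>Surjectivity gives preimages of 0 and 1; by monotonicity
    \<open>f i 0 \<le> f i y = 0\<close> and \<open>1 = f i z \<le> f i 1\<close>.\<close>
  obtain y z where "y \<in> I01" "f i y = 0" "z \<in> I01" "f i z = 1"
    using img by (metis (no_types, lifting) atLeastAtMost_iff imageE order_refl zero_le_one)
  moreover have "f i 0 \<in> I01" "f i 1 \<in> I01"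
    using img by force+
  ultimately show "f i 0 = 0" "f i 1 = 1"
    using strict_mono_on_leD[OF mono, of 0 y] strict_mono_on_leD[OF mono, of z 1] by auto
qed fact+

text \<open>Each endpoint gets its own negative power, controlled by \<open>powr_drift\<close> for
  the maps and for their reflections. Since both powers blow up at their endpoints, a bound on
  \<open>V\<close> keeps points away from 0 and 1.\<close>

lemma (in increasing_ifs) boundary_lyapunov:
  assumes slope_0: "\<And>i. i \<in> {1..m} \<Longrightarrow> ((\<lambda>x. f i x / x) \<longlongrightarrow> d0 i) (at_right 0)"
    and slope_1: "\<And>i. i \<in> {1..m} \<Longrightarrow> ((\<lambda>x. (1 - f i (1 - x)) / x) \<longlongrightarrow> d1 i) (at_right 0)"
    and d_pos: "\<And>i. i \<in> {1..m} \<Longrightarrow> d0 i > 0" "\<And>i. i \<in> {1..m} \<Longrightarrow> d1 i > 0"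
    and exponents: "(\<Sum>i=1..m. p i * ln (d0 i)) > 0" "(\<Sum>i=1..m. p i * ln (d1 i)) > 0"
  shows "\<exists>V \<kappa> K. V \<in> borel_measurable borel \<and> (\<forall>x. V x \<ge> 0) \<and> 0 < \<kappa> \<and> \<kappa> < 1 \<and> K \<ge> 0 \<and>
    (\<forall>x\<in>{0<..<1}. U V x \<le> \<kappa> * V x + K * (1 - \<kappa>)) \<and>
    (\<forall>R>0. \<exists>a\<in>{0<..<1}. \<exists>b\<in>{0<..<1}. \<forall>x\<in>{0<..<1}. V x \<le> R \<longrightarrow> a \<le> x \<and> x \<le> b)"
proof -
  have mono: "mono_on {0<..<1} (f i)" "mono_on {0<..<1} (\<lambda>x. 1 - f i (1 - x))" if i: "i \<in> {1..m}" for i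
    by (auto intro!: mono_onI f_mono[OF i])
  have pos: "f i x > 0" "1 - f i (1 - x) > 0" if i: "i \<in> {1..m}" and "x \<in> {0<..<1}" for i x
    using f_open[OF i, of x] f_open[OF i, of "1 - x"] that by auto
  obtain \<alpha>0 \<kappa>0 K0 where d0: "0 < \<alpha>0" "0 < \<kappa>0" "\<kappa>0 < 1" "0 \<le> K0"
    "\<And>x. x \<in> {0<..<1} \<Longrightarrow> (\<Sum>i=1..m. p i * f i x powr (-\<alpha>0)) \<le> \<kappa>0 * x powr (-\<alpha>0) + K0"
    using powr_drift[OF p_pos p_sum d_pos(1) exponents(1) slope_0 pos(1) mono(1)] by blast
  obtain \<alpha>1 \<kappa>1 K1 where d1: "0 < \<alpha>1" "0 < \<kappa>1" "\<kappa>1 < 1" "0 \<le> K1"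
    "\<And>x. x \<in> {0<..<1} \<Longrightarrow>
      (\<Sum>i=1..m. p i * (1 - f i (1 - x)) powr (-\<alpha>1)) \<le> \<kappa>1 * x powr (-\<alpha>1) + K1"
    using powr_drift[OF p_pos p_sum d_pos(2) exponents(2) slope_1 pos(2) mono(2)] by blast
  \<comment> \<open>At the endpoints \<open>0 powr _ = 0\<close> gives \<open>V\<close> the value 1
    instead of infinity; the drift and sublevel claims concern the open interval only.\<close>
  define V where "V x = x powr (-\<alpha>0) + (1 - x) powr (-\<alpha>1)" for x
  define \<kappa> where "\<kappa> = max \<kappa>0 \<kappa>1"
  define K where "K = (K0 + K1) / (1 - \<kappa>)"
  have \<kappa>: "0 < \<kappa>" "\<kappa> < 1" using d0 d1 by (auto simp: \<kappa>_def)
  show ?thesis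
  proof (rule exI[of _ V], rule exI[of _ \<kappa>], rule exI[of _ K], intro conjI allI ballI impI)
    show "V \<in> borel_measurable borel" unfolding V_def[abs_def] by measurable
    show "V x \<ge> 0" for x by (simp add: V_def)
    show "K \<ge> 0" using \<kappa> d0 d1 by (simp add: K_def)
    show "U V x \<le> \<kappa> * V x + K * (1 - \<kappa>)" if x: "x \<in> {0<..<1}" for x
    proof -
      have "U V x = (\<Sum>i=1..m. p i * f i x powr (-\<alpha>0)) + (\<Sum>i=1..m. p i * (1 - f i x) powr (-\<alpha>1))"
        by (simp add: markov_op_def V_def distrib_left sum.distrib)
      also have "\<dots> \<le> (\<kappa>0 * x powr (-\<alpha>0) + K0) + (\<kappa>1 * (1 - x) powr (-\<alpha>1) + K1)"
        using d0(5)[OF x] d1(5)[of "1 - x"] x by simp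
      also have "\<dots> \<le> (\<kappa> * x powr (-\<alpha>0) + K0) + (\<kappa> * (1 - x) powr (-\<alpha>1) + K1)"
        by (intro add_mono mult_right_mono) (auto simp: \<kappa>_def)
      also have "\<dots> = \<kappa> * V x + K * (1 - \<kappa>)"
        using \<kappa> by (simp add: V_def K_def distrib_left)
      finally show ?thesis .
    qed
    show "\<exists>a\<in>{0<..<1}. \<exists>b\<in>{0<..<1}. \<forall>x\<in>{0<..<1}. V x \<le> R \<longrightarrow> a \<le> x \<and> x \<le> b" if R: "R > 0" for R
    proof -
      \<comment> \<open>The powers are inverted to find how far from each endpoint
        \<open>V x \<le> R\<close> forces \<open>x\<close> to be; the cap 1/2 keeps the witnesses
        interior when \<open>R\<close> is small.\<close>
      define a where "a = min (1/2) (R powr (-1/\<alpha>0))"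
      define b where "b = 1 - min (1/2) (R powr (-1/\<alpha>1))"
      have "a \<le> x \<and> x \<le> b" if x: "x \<in> {0<..<1}" and "V x \<le> R" for x
      proof -
        have "x powr (-\<alpha>0) \<le> R" "(1 - x) powr (-\<alpha>1) \<le> R"
          using \<open>V x \<le> R\<close> powr_ge_zero[of x "-\<alpha>0"] powr_ge_zero[of "1 - x" "-\<alpha>1"]
          unfolding V_def by linarith+
        then show ?thesis
          using powr_neg_le_imp_ge[of \<alpha>0 x R] powr_neg_le_imp_ge[of \<alpha>1 "1 - x" R] x R d0(1) d1(1)
          by (auto simp: a_def b_def)
      qed
      moreover have "a \<in> {0<..<1}" "b \<in> {0<..<1}"
        using R by (auto simp: a_def b_def min_def)
      ultimately show ?thesis by blast
    qed
  qed fact+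
qed

section \<open>Lipschitz norms and the final estimate\<close>

lemma lipschitz_01_norms:
  assumes "lipschitz_01 \<phi>"
  shows "continuous_on I01 \<phi>"
    and "x \<in> I01 \<Longrightarrow> \<bar>\<phi> x\<bar> \<le> sup_norm_01 \<phi>"
    and "x \<in> I01 \<Longrightarrow> y \<in> I01 \<Longrightarrow> \<bar>\<phi> x - \<phi> y\<bar> \<le> Lip_const_01 \<phi> * \<bar>x - y\<bar>"
    and "0 \<le> sup_norm_01 \<phi>" and "0 \<le> Lip_const_01 \<phi>"
proof -
  obtain L where L: "L-lipschitz_on I01 \<phi>"
    using assms by (auto simp: lipschitz_01_def)
  show cont: "continuous_on I01 \<phi>"
    by (rule lipschitz_on_continuous_on[OF L])
  have "bdd_above ((\<lambda>x. \<bar>\<phi> x\<bar>) ` I01)"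
    by (intro compact_imp_bounded[THEN bounded_imp_bdd_above] compact_continuous_image
        continuous_on_rabs cont compact_Icc)
  then show sup: "\<bar>\<phi> x\<bar> \<le> sup_norm_01 \<phi>" if "x \<in> I01" for x
    unfolding sup_norm_01_def using that by (intro cSUP_upper)
  show "0 \<le> sup_norm_01 \<phi>"
    using sup[of 0] by simp
  show "0 \<le> Lip_const_01 \<phi>"
    unfolding Lip_const_01_def using L by (intro cInf_greatest) (auto dest: lipschitz_on_nonneg)
  show "\<bar>\<phi> x - \<phi> y\<bar> \<le> Lip_const_01 \<phi> * \<bar>x - y\<bar>" if xy: "x \<in> I01" "y \<in> I01" for x y
  proof (cases "x = y")
    case False
    \<comment> \<open>The difference quotient is a lower bound of all admissible constants, so the
      infimum is itself admissible.\<close>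
    have "\<bar>\<phi> x - \<phi> y\<bar> / \<bar>x - y\<bar> \<le> Lip_const_01 \<phi>"
      unfolding Lip_const_01_def
    proof (rule cInf_greatest)
      fix M assume "M \<in> {L. L-lipschitz_on I01 \<phi>}"
      then have "\<bar>\<phi> x - \<phi> y\<bar> \<le> M * \<bar>x - y\<bar>"
        using lipschitz_onD[of M I01 \<phi> x y] xy by (simp add: dist_real_def)
      then show "\<bar>\<phi> x - \<phi> y\<bar> / \<bar>x - y\<bar> \<le> M"
        using False by (simp add: divide_le_eq)
    qed (use L in auto)
    then show ?thesis using False by (simp add: divide_le_eq)
  qed simp
qed

theorem corollary1:
  fixes m :: nat
    and p :: "nat \<Rightarrow> real"
    and f :: "nat \<Rightarrow> real \<Rightarrow> real"
    and \<mu> :: "real measure"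
  assumes p_pos: "\<And>i. i \<in> {1..m} \<Longrightarrow> p i > 0"
    and p_sum: "(\<Sum>i=1..m. p i) = 1"
    and A1: "\<And>i. i \<in> {1..m} \<Longrightarrow> C2_diffeo_01 (f i) \<and> strict_mono_on {0..1} (f i)"
    and A2: "\<And>x. x \<in> {0<..<1} \<Longrightarrow> \<exists>i\<in>{1..m}. \<exists>j\<in>{1..m}. f i x < x \<and> x < f j x"
    and A3: "(\<Sum>i=1..m. p i * ln (deriv01 (f i) 0)) > 0"
            "(\<Sum>i=1..m. p i * ln (deriv01 (f i) 1)) > 0"
    and \<mu>_prob: "borel_prob_01 \<mu>"
    and \<mu>_stationary: "stationary m p f \<mu>"
    and \<mu>_interior: "measure \<mu> {0<..<1} = 1"
  shows "\<exists>q C. 0 < q \<and> q < 1 \<and> 1 \<le> C \<and>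
    (\<forall>\<phi> \<psi> :: real \<Rightarrow> real. \<forall>n::nat. lipschitz_01 \<phi> \<longrightarrow> lipschitz_01 \<psi> \<longrightarrow> n \<ge> 1 \<longrightarrow>
      \<bar>(\<integral>x. (markov_op m p f ^^ n) \<phi> x * \<psi> x \<partial>\<mu>) - (\<integral>x. \<phi> x \<partial>\<mu>) * (\<integral>x. \<psi> x \<partial>\<mu>)\<bar>
        \<le> C * Lip_norm_01 \<phi> * Lip_norm_01 \<psi> * q ^ n)"
proof -
  interpret increasing_ifs m p f
    by (rule increasing_ifs_diffeo[OF p_pos p_sum A1])
  interpret prob_space \<mu>
    using \<mu>_prob by (simp add: borel_prob_01_def)
  interpret stationary_ifs m p f \<mu>
    using \<mu>_prob \<mu>_stationary by unfold_locales (simp_all add: borel_prob_01_def)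
  have "{0<..<1::real} \<in> sets \<mu>"
    unfolding sets_\<mu> by (auto simp: sets_restrict_space intro!: image_eqI[of _ _ "{0<..<1}"])
  then have interior: "AE x in \<mu>. x \<in> {0<..<1}"
    using prob_eq_1 \<mu>_interior by blast
  have deriv: "(f i has_real_derivative deriv01 (f i) x) (at x within I01)" "deriv01 (f i) x > 0"
    if "i \<in> {1..m}" "x \<in> I01" for i x
    using A1[OF that(1)] that(2) has_deriv01 deriv01_pos by (auto simp: C2_diffeo_01_def)
  have slope: "((\<lambda>x. f i x / x) \<longlongrightarrow> deriv01 (f i) 0) (at_right 0)"
      "((\<lambda>x. (1 - f i (1 - x)) / x) \<longlongrightarrow> deriv01 (f i) 1) (at_right 0)"
    and deriv_pos: "deriv01 (f i) 0 > 0" "deriv01 (f i) 1 > 0" if i: "i \<in> {1..m}" for i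
    using deriv[OF i, of 0] deriv[OF i, of 1] f_0[OF i] f_1[OF i] slope_at_0 slope_at_1 by auto
  obtain V \<kappa> K where V_meas: "V \<in> borel_measurable borel" and V: "\<And>x. V x \<ge> 0"
    and \<kappa>: "0 < \<kappa>" "\<kappa> < 1" and K: "K \<ge> 0"
    and drift: "\<And>x. x \<in> {0<..<1} \<Longrightarrow> U V x \<le> \<kappa> * V x + K * (1 - \<kappa>)"
    and sublevel: "\<And>R. R > 0 \<Longrightarrow> \<exists>a\<in>{0<..<1}. \<exists>b\<in>{0<..<1}. \<forall>x\<in>{0<..<1}. V x \<le> R \<longrightarrow> a \<le> x \<and> x \<le> b"
    using boundary_lyapunov[OF slope(1,2) deriv_pos(1,2) A3] by metis
  have "(\<lambda>x. x) \<in> borel_measurable \<mu>"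
    by (intro borel_measurable_cont continuous_on_id)
  then have V_meas_\<mu>: "V \<in> borel_measurable \<mu>"
    using measurable_compose[OF _ V_meas] by blast
  have V_int: "integrable \<mu> V"
    by (rule integrable_drift_function[OF interior \<kappa> K V_meas_\<mu> V drift])
  obtain q C \<beta> where q: "0 < q" "q < 1" and C: "C \<ge> 0" and \<beta>: "\<beta> > 0"
    and osc: "\<And>n x y. 0 < x \<Longrightarrow> x \<le> y \<Longrightarrow> y < 1 \<Longrightarrow>
      (U ^^ n) (\<lambda>x. x) y - (U ^^ n) (\<lambda>x. x) x \<le> C * q ^ n * (2 + \<beta> * V x + \<beta> * V y)"
    using identity_oscillation_decay[OF A2 \<kappa> K V drift sublevel] by metis
  \<comment> \<open>The maximum with 1 secures the required \<open>1 \<le> C'\<close>.\<close>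
  define C' where "C' = max 1 (C * (2 + 2 * \<beta> * (\<integral>x. V x \<partial>\<mu>)))"
  have "\<bar>(\<integral>x. (U ^^ n) \<phi> x * \<psi> x \<partial>\<mu>) - (\<integral>x. \<phi> x \<partial>\<mu>) * (\<integral>x. \<psi> x \<partial>\<mu>)\<bar>
      \<le> C' * Lip_norm_01 \<phi> * Lip_norm_01 \<psi> * q ^ n"
    if \<phi>: "lipschitz_01 \<phi>" and \<psi>: "lipschitz_01 \<psi>" for \<phi> \<psi> n
  proof -
    note N\<phi> = lipschitz_01_norms[OF \<phi>] and N\<psi> = lipschitz_01_norms[OF \<psi>]
    have obs: "bounded_obs \<phi> (sup_norm_01 \<phi>)" "bounded_obs \<psi> (sup_norm_01 \<psi>)"
      using N\<phi>(1,2) N\<psi>(1,2) borel_measurable_cont by (auto simp: bounded_obs_def)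
    have "\<bar>(\<integral>x. (U ^^ n) \<phi> x * \<psi> x \<partial>\<mu>) - (\<integral>x. \<phi> x \<partial>\<mu>) * (\<integral>x. \<psi> x \<partial>\<mu>)\<bar>
      \<le> Lip_const_01 \<phi> * sup_norm_01 \<psi> * (C * q ^ n) * (2 + 2 * \<beta> * (\<integral>x. V x \<partial>\<mu>))"
      using C q by (intro correlation_decay[OF interior V_int _ osc obs(1) N\<phi>(3,5) obs(2)]) auto
    also have "\<dots> = (Lip_const_01 \<phi> * sup_norm_01 \<psi>) * (C * (2 + 2 * \<beta> * (\<integral>x. V x \<partial>\<mu>))) * q ^ n"
      by (simp only: mult_ac)
    \<comment> \<open>Each of the two factors is one summand of the corresponding norm, whose other
      summand is nonnegative.\<close>
    also have "\<dots> \<le> (Lip_norm_01 \<phi> * Lip_norm_01 \<psi>) * C' * q ^ n"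
      using N\<phi>(4,5) N\<psi>(4,5) q C \<beta> Bochner_Integration.integral_nonneg[of \<mu> V, OF V]
      by (intro mult_right_mono mult_mono) (auto simp: Lip_norm_01_def C'_def)
    finally show ?thesis by (simp only: mult_ac)
  qed
  moreover have "1 \<le> C'" by (simp add: C'_def)
  ultimately show ?thesis using q by blast
qed

end
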